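(* Let $N$ be a gammoid. There is an excluded minor, $M$, for the class of gammoids, such that $M$ has an $N$-minor.
   Context: Matroids and directed graphs are finite. Let $G$ be a directed graph with vertex set $V$ and let $T\subseteq V$. A subset $X\subseteq V$ is linked to $T$ (in $G$) if there is a collection of $|X|$ pairwise vertex-disjoint directed paths of $G$, each of which begins with a vertex in $X$ and ends with a vertex in $T$ (a path may consist of a single vertex, when that vertex belongs to both $X$ and $T$). The subsets of $V$ that are linked to $T$ form the independent sets of a matroid on $V$. For $S\subseteq V$, $L(G,S,T)$ denotes the restriction of this matroid to $S$; thus its ground set is $S$ and its independent sets are exactly the subsets of $S$ that are linked to $T$ in $G$. A gammoid is any matroid of the form $L(G,S,T)$ (up to isomorphism). The class of gammoids is closed under taking minors. An excluded minor for the class of gammoids is a matroid $M$ that is not a gammoid, but such that for every element $e$ of the ground set of $M$ both the deletion $M\backslash e$ and the contraction $M/e$ are gammoids. "$M$ has an $N$-minor" means that some minor of $M$ is isomorphic to $N$. *)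

theory Defs
  imports "Graph_Theory.Graph_Theory"
begin

section \<open>Finite matroids\<close>

record 'a pre_matroid =
  ground :: "'a set"
  indep_sets :: "'a set set"

locale matroid =
  fixes M :: "'a pre_matroid"
  assumes finite_ground: "finite (ground M)"
    and indep_subset_ground: "X \<in> indep_sets M \<Longrightarrow> X \<subseteq> ground M"
    and empty_indep: "{} \<in> indep_sets M"
    and indep_subset: "X \<in> indep_sets M \<Longrightarrow> Y \<subseteq> X \<Longrightarrow> Y \<in> indep_sets M"
    and augment: "X \<in> indep_sets M \<Longrightarrow> Y \<in> indep_sets M \<Longrightarrow> card X < card Y \<Longrightarrow>
      \<exists>y\<in>Y - X. insert y X \<in> indep_sets M"

definition matroid_iso :: "'a pre_matroid \<Rightarrow> 'b pre_matroid \<Rightarrow> bool" where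
  "matroid_iso M N \<longleftrightarrow> (\<exists>f. bij_betw f (ground M) (ground N) \<and>
     (\<forall>X. X \<subseteq> ground M \<longrightarrow> (X \<in> indep_sets M \<longleftrightarrow> f ` X \<in> indep_sets N)))"

definition restriction :: "'a pre_matroid \<Rightarrow> 'a set \<Rightarrow> 'a pre_matroid" where
  "restriction M S = \<lparr>ground = S, indep_sets = {X \<in> indep_sets M. X \<subseteq> S}\<rparr>"

definition deletion :: "'a pre_matroid \<Rightarrow> 'a set \<Rightarrow> 'a pre_matroid" where
  "deletion M D = restriction M (ground M - D)"

definition basis_of :: "'a pre_matroid \<Rightarrow> 'a set \<Rightarrow> 'a set \<Rightarrow> bool" where
  "basis_of M C B \<longleftrightarrow> B \<in> indep_sets M \<and> B \<subseteq> C \<and>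
     (\<forall>B'. B' \<in> indep_sets M \<and> B \<subseteq> B' \<and> B' \<subseteq> C \<longrightarrow> B' = B)"

definition contraction :: "'a pre_matroid \<Rightarrow> 'a set \<Rightarrow> 'a pre_matroid" where
  "contraction M C = \<lparr>ground = ground M - C,
     indep_sets = {X. X \<subseteq> ground M - C \<and> (\<exists>B. basis_of M C B \<and> X \<union> B \<in> indep_sets M)}\<rparr>"

definition is_minor :: "'a pre_matroid \<Rightarrow> 'a pre_matroid \<Rightarrow> bool" where
  "is_minor M' M \<longleftrightarrow> (\<exists>C D. C \<subseteq> ground M \<and> D \<subseteq> ground M \<and> C \<inter> D = {} \<and>
     M' = deletion (contraction M C) D)"

definition has_minor :: "'a pre_matroid \<Rightarrow> 'b pre_matroid \<Rightarrow> bool" where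
  "has_minor M N \<longleftrightarrow> (\<exists>M'. is_minor M' M \<and> matroid_iso M' N)"

definition excluded_minor :: "('a pre_matroid \<Rightarrow> bool) \<Rightarrow> 'a pre_matroid \<Rightarrow> bool" where
  "excluded_minor \<C> M \<longleftrightarrow> matroid M \<and> \<not> \<C> M \<and>
     (\<forall>e\<in>ground M. \<C> (deletion M {e}) \<and> \<C> (contraction M {e}))"

section \<open>Gammoids\<close>

definition linked :: "('v, 'e) pre_digraph \<Rightarrow> 'v set \<Rightarrow> 'v set \<Rightarrow> bool" where
  "linked G X T \<longleftrightarrow> X \<subseteq> verts G \<and>
     (\<exists>P. finite P \<and> card P = card X \<and>
        (\<forall>p\<in>P. vpath p G \<and> hd p \<in> X \<and> last p \<in> T) \<and>
        (\<forall>p\<in>P. \<forall>q\<in>P. p \<noteq> q \<longrightarrow> set p \<inter> set q = {}))"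

definition linkage_matroid :: "('v, 'e) pre_digraph \<Rightarrow> 'v set \<Rightarrow> 'v pre_matroid" where
  "linkage_matroid G T = \<lparr>ground = verts G, indep_sets = {X. linked G X T}\<rparr>"

definition gammoid_L :: "('v, 'e) pre_digraph \<Rightarrow> 'v set \<Rightarrow> 'v set \<Rightarrow> 'v pre_matroid" where
  "gammoid_L G S T = restriction (linkage_matroid G T) S"

text \<open>
  HOL cannot quantify over the vertex type, so the vertices are natural numbers; every finite
  digraph is isomorphic to one of these. Loops are allowed. Arcs are ordered pairs of
  vertices, since parallel arcs do not affect which sets are linked.
\<close>
definition gammoid :: "'a pre_matroid \<Rightarrow> bool" where
  "gammoid M \<longleftrightarrow> matroid M \<and>
     (\<exists>(G :: nat pair_pre_digraph) S T. pair_fin_digraph G \<and> S \<subseteq> pverts G \<and> T \<subseteq> pverts G \<and>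
        matroid_iso M (gammoid_L (with_proj G) S T))"

end

theory Submission
  imports Defs "HOL-Computational_Algebra.Polynomial" "HOL-Library.Countable"
begin

text \<open>
  Linkings of \<open>X\<close> to \<open>T\<close> correspond to injections of \<open>V - T\<close> into \<open>V - X\<close> that fix each vertex or
  move it along an arc. This shows that gammoids are contractions of transversal matroids, hence
  representable over the reals and closed under contraction, and that a vertex without in-arcs is
  placed freely on the span of its out-neighbours.

  Now let \<open>B\<close>, \<open>C\<close>, \<open>D\<close> be independent sets of size \<open>n\<close> in a gammoid of rank \<open>2n + 1\<close> such that the union
  of any two of them is an independent flat; every gammoid is a minor of one such.
  Add a coloop \<open>p\<close> and a generic point \<open>a\<close> of the old span, place \<open>a1\<close>, \<open>a2\<close> freely on the line \<open>pa\<close>,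
  place \<open>b\<close>, \<open>c\<close>, \<open>d\<close> freely on \<open>Bp\<close>, \<open>Cp\<close>, \<open>Dp\<close>, and delete \<open>p\<close> and \<open>a\<close>. As in the Vamos matroid, the
  spans of \<open>{a1, a2}\<close>, \<open>Bb\<close>, \<open>Cc\<close> and \<open>Dd\<close> all contain \<open>p\<close>, and Ingleton's argument shows that in a
  representable matroid the other incidences force \<open>CcDd\<close> to be dependent. This set is a
  circuit-hyperplane, and relaxing it gives the excluded minor: once an element is deleted or
  contracted, the relaxation is realised by placing \<open>d\<close> (or symmetrically \<open>c\<close>) freely on a slightly
  larger flat than \<open>Dp\<close>.
\<close>

section \<open>Linkings as injections\<close>

definition linkable :: "'v set \<Rightarrow> 'v set \<Rightarrow> ('v \<Rightarrow> 'v set) \<Rightarrow> 'v set \<Rightarrow> bool" where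
  "linkable V T out X \<longleftrightarrow> X \<subseteq> V \<and>
     (\<exists>g. inj_on g (V - T) \<and> (\<forall>v\<in>V - T. g v \<in> V - X \<and> (g v = v \<or> g v \<in> out v)))"

lemma linkableI:
  assumes "X \<subseteq> V" "inj_on g (V - T)" "\<And>v. v \<in> V - T \<Longrightarrow> g v \<in> V - X \<and> (g v = v \<or> g v \<in> out v)"
  shows "linkable V T out X"
  using assms unfolding linkable_def by blast

lemma linkableE:
  assumes "linkable V T out X"
  obtains g where "X \<subseteq> V" "inj_on g (V - T)"
    "\<And>v. v \<in> V - T \<Longrightarrow> g v \<in> V" "\<And>v. v \<in> V - T \<Longrightarrow> g v \<notin> X"
    "\<And>v. v \<in> V - T \<Longrightarrow> g v = v \<or> g v \<in> out v"
  using assms unfolding linkable_def by blast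

lemma linkable_subset: "linkable V T out X \<Longrightarrow> Y \<subseteq> X \<Longrightarrow> linkable V T out Y"
  unfolding linkable_def by blast

lemma set_vwalk_arcs: "set (vwalk_arcs p) = {(p ! i, p ! Suc i) | i. Suc i < length p}"
proof (induction p rule: vwalk_arcs.induct)
  case (3 x y xs)
  have "{((x # y # xs) ! i, (x # y # xs) ! Suc i) | i. Suc i < length (x # y # xs)}
      = insert (x, y) {((y # xs) ! i, (y # xs) ! Suc i) | i. Suc i < length (y # xs)}"
    (is "?L = ?R")
  proof (intro equalityI subsetI)
    fix e assume "e \<in> ?L"
    then obtain i where "e = ((x # y # xs) ! i, (x # y # xs) ! Suc i)" "Suc i < length (x # y # xs)"
      by blast
    then show "e \<in> ?R" by (cases i) auto
  next
    fix e assume "e \<in> ?R"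
    then consider "e = (x, y)"
      | i where "e = ((y # xs) ! i, (y # xs) ! Suc i)" "Suc i < length (y # xs)" by blast
    then show "e \<in> ?L"
    proof cases
      case 1
      then show ?thesis by (intro CollectI exI[of _ 0]) auto
    next
      case (2 i)
      then show ?thesis by (intro CollectI exI[of _ "Suc i"]) auto
    qed
  qed
  with 3 show ?case by simp
qed auto

lemma linked_imp_linkable:
  assumes "linked G X T" "finite (verts G)"
  shows "linkable (verts G) T (\<lambda>v. {w. (v, w) \<in> arcs_ends G}) X"
proof -
  have X: "X \<subseteq> verts G" using assms(1) unfolding linked_def by (rule conjunct1)
  obtain P where P: "finite P" "card P = card X"
    and paths: "\<forall>p\<in>P. vpath p G \<and> hd p \<in> X \<and> last p \<in> T"
    and disj: "\<forall>p\<in>P. \<forall>q\<in>P. p \<noteq> q \<longrightarrow> set p \<inter> set q = {}"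
    using assms(1) unfolding linked_def by (elim conjE exE)
  have path: "vpath p G" and hdp: "hd p \<in> X" and lastp: "last p \<in> T" if "p \<in> P" for p
    using paths that by simp_all
  note disj = disj[rule_format]
  have ne: "p \<noteq> []" and dp: "distinct p" and sp: "set p \<subseteq> verts G"
    and ap: "set (vwalk_arcs p) \<subseteq> arcs_ends G" if "p \<in> P" for p
    using path[OF that] by (auto simp: vpath_def vwalk_def)
  have "inj_on hd P"
    using disj ne by (intro inj_onI) (metis disjoint_iff hd_in_set)
  moreover have "finite X" using X assms(2) finite_subset by blast
  ultimately have hdP: "hd ` P = X"
    using P hdp by (intro card_subset_eq) (auto simp: card_image)
  define step where "step v w \<longleftrightarrow> (\<exists>p\<in>P. \<exists>i. Suc i < length p \<and> v = p ! i \<and> w = p ! Suc i)" for v w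
  define off where "off v \<longleftrightarrow> (\<forall>p\<in>P. v \<notin> set p)" for v
  have "\<exists>w. (off v \<and> w = v) \<or> step v w" if "v \<in> verts G - T" for v
  proof (cases "off v")
    case False
    then obtain p where p: "p \<in> P" "v \<in> set p" unfolding off_def by blast
    then obtain i where i: "i < length p" "v = p ! i" by (metis in_set_conv_nth)
    have "Suc i \<noteq> length p"
    proof
      assume "Suc i = length p"
      then have "last p = v" using i ne[OF p(1)] by (simp add: last_conv_nth flip: \<open>Suc i = length p\<close>)
      then show False using lastp[OF p(1)] that by simp
    qed
    then show ?thesis using p i unfolding step_def by (metis Suc_lessI)
  qed auto
  then obtain g where g: "\<And>v. v \<in> verts G - T \<Longrightarrow> (off v \<and> g v = v) \<or> step v (g v)" by metis
  have step_on: "\<not> off w" if "step v w" for v w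
    using that unfolding step_def off_def by (metis nth_mem)
  have step_inj: "v = v'" if st: "step v w" "step v' w" for v v' w
  proof -
    obtain p i where p: "p \<in> P" "Suc i < length p" "v = p ! i" "w = p ! Suc i"
      using st(1) unfolding step_def by blast
    obtain q j where q: "q \<in> P" "Suc j < length q" "v' = q ! j" "w = q ! Suc j"
      using st(2) unfolding step_def by blast
    have "w \<in> set p" "w \<in> set q"
      using nth_mem[OF p(2)] nth_mem[OF q(2)] p(4) q(4) by simp_all
    then have "p = q" using disj[OF p(1) q(1)] by blast
    then have "Suc i = Suc j"
      using p q nth_eq_iff_index_eq[OF dp[OF p(1)], of "Suc i" "Suc j"] by simp
    then show ?thesis using p q \<open>p = q\<close> by simp
  qed
  have step_X: "w \<notin> X" if st: "step v w" for v w
  proof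
    assume "w \<in> X"
    then obtain q where q: "q \<in> P" "w = hd q" using hdP by blast
    obtain p i where p: "p \<in> P" "Suc i < length p" "w = p ! Suc i"
      using st unfolding step_def by blast
    have "w \<in> set p" "w \<in> set q"
      using nth_mem[OF p(2)] p(3) q(2) hd_in_set[OF ne[OF q(1)]] by simp_all
    then have "p = q" using disj[OF p(1) q(1)] by blast
    then have "p ! Suc i = p ! 0" using p q ne[OF q(1)] by (simp add: hd_conv_nth)
    then show False using nth_eq_iff_index_eq[OF dp[OF p(1)], of "Suc i" 0] p(2) ne[OF p(1)] by auto
  qed
  show ?thesis
  proof (rule linkableI[where g = g])
    show "inj_on g (verts G - T)"
    proof (rule inj_onI)
      fix v w assume vw: "v \<in> verts G - T" "w \<in> verts G - T" "g v = g w"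
      show "v = w" using g[OF vw(1)] g[OF vw(2)] vw(3) step_on step_inj by metis
    qed
    fix v assume v: "v \<in> verts G - T"
    show "g v \<in> verts G - X \<and> (g v = v \<or> g v \<in> {w. (v, w) \<in> arcs_ends G})"
    proof (cases "off v \<and> g v = v")
      case True
      then have "v \<notin> X" using hdP ne unfolding off_def by (metis hd_in_set imageE)
      then show ?thesis using True v by simp
    next
      case False
      then have st: "step v (g v)" using g[OF v] by blast
      then obtain p i where p: "p \<in> P" "Suc i < length p" "v = p ! i" "g v = p ! Suc i"
        unfolding step_def by blast
      then have "(v, g v) \<in> arcs_ends G" "g v \<in> verts G"
        using ap[OF p(1)] sp[OF p(1)] by (auto simp: set_vwalk_arcs)
      then show ?thesis using step_X[OF st] by simp
    qed
  qed (rule X)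
qed

lemma linkable_imp_linked:
  assumes "linkable (verts G) T (\<lambda>v. {w. (v, w) \<in> arcs_ends G}) X" "finite (verts G)"
  shows "linked G X T"
proof -
  let ?V = "verts G"
  obtain g where X: "X \<subseteq> ?V" and inj: "inj_on g (?V - T)"
    and gV: "\<And>v. v \<in> ?V - T \<Longrightarrow> g v \<in> ?V" and gX: "\<And>v. v \<in> ?V - T \<Longrightarrow> g v \<notin> X"
    and garc: "\<And>v. v \<in> ?V - T \<Longrightarrow> g v = v \<or> (v, g v) \<in> arcs_ends G"
    using assms(1) by (rule linkableE) blast
  have meet: "i = j \<and> x = y"
    if "x \<in> X" "y \<in> X" "\<forall>k<i. (g ^^ k) x \<in> ?V - T" "\<forall>k<j. (g ^^ k) y \<in> ?V - T"
      "(g ^^ i) x = (g ^^ j) y" for x y i j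
    using that
  proof (induction i arbitrary: j)
    case 0
    show ?case
    proof (cases j)
      case 0
      then show ?thesis using \<open>(g ^^ 0) x = (g ^^ j) y\<close> by simp
    next
      case (Suc j')
      then have "g ((g ^^ j') y) \<in> X" "(g ^^ j') y \<in> ?V - T" using 0 by auto
      then show ?thesis using gX by blast
    qed
  next
    case (Suc i)
    show ?case
    proof (cases j)
      case 0
      then have "g ((g ^^ i) x) \<in> X" "(g ^^ i) x \<in> ?V - T" using Suc.prems by auto
      then show ?thesis using gX by blast
    next
      case (Suc j')
      then have "(g ^^ i) x = (g ^^ j') y"
        using Suc.prems inj_onD[OF inj] by auto
      then show ?thesis using Suc.IH[of j'] Suc.prems \<open>j = Suc j'\<close> by auto
    qed
  qed
  have ex: "\<exists>k. (g ^^ k) x \<in> T" if "x \<in> X" for x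
  proof (rule ccontr)
    assume "\<nexists>k. (g ^^ k) x \<in> T"
    then have nT: "(g ^^ k) x \<notin> T" for k by blast
    have V: "(g ^^ k) x \<in> ?V" for k
    proof (induction k)
      case (Suc k)
      then show ?case using gV nT by auto
    qed (use that X in auto)
    have "inj (\<lambda>k. (g ^^ k) x)"
      using meet[OF that that] V nT by (intro injI) blast
    moreover have "finite (range (\<lambda>k. (g ^^ k) x))"
      using V assms(2) by (meson finite_subset image_subsetI)
    ultimately show False using finite_imageD by blast
  qed
  define len where "len x = (LEAST k. (g ^^ k) x \<in> T)" for x
  have lenT: "(g ^^ len x) x \<in> T" if "x \<in> X" for x
    unfolding len_def using ex[OF that] by (rule LeastI_ex)
  have notT: "(g ^^ k) x \<notin> T" if "k < len x" for x k
    using that unfolding len_def by (rule not_less_Least)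
  have V: "(g ^^ k) x \<in> ?V" if "x \<in> X" "k \<le> len x" for x k
    using that(2)
  proof (induction k)
    case (Suc k)
    then have "(g ^^ k) x \<notin> T" by (intro notT) simp
    then show ?case using gV Suc by auto
  qed (use that X in auto)
  have nT: "(g ^^ k) x \<in> ?V - T" if "x \<in> X" "k < len x" for x k
    using V[OF that(1), of k] notT[OF that(2)] that(2) by simp
  have uniq: "i = j \<and> x = y"
    if "x \<in> X" "y \<in> X" "i \<le> len x" "j \<le> len y" "(g ^^ i) x = (g ^^ j) y" for x y i j
  proof (rule meet[OF that(1,2) _ _ that(5)])
    show "\<forall>k<i. (g ^^ k) x \<in> ?V - T" using nT[OF that(1)] that(3) by auto
    show "\<forall>k<j. (g ^^ k) y \<in> ?V - T" using nT[OF that(2)] that(4) by auto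
  qed
  define path where "path x = map (\<lambda>i. (g ^^ i) x) [0..<Suc (len x)]" for x
  have setp: "set (path x) = (\<lambda>i. (g ^^ i) x) ` {..len x}" for x
    unfolding path_def by (auto simp: atLeast0LessThan lessThan_Suc_atMost simp del: upt_Suc)
  have hd: "hd (path x) = x" for x unfolding path_def by (simp add: hd_map upt_rec)
  have last: "last (path x) = (g ^^ len x) x" for x unfolding path_def by simp
  have "vpath (path x) G" if "x \<in> X" for x
  proof (intro vpathI vwalkI)
    show "set (path x) \<subseteq> ?V" using V[OF that] unfolding setp by auto
    show "path x \<noteq> []" unfolding path_def by simp
    have "inj_on (\<lambda>i. (g ^^ i) x) {0..<Suc (len x)}"
      using uniq[OF that that] by (intro inj_onI) auto
    then show "distinct (path x)"
      unfolding path_def distinct_map by (simp del: upt_Suc)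
    show "set (vwalk_arcs (path x)) \<subseteq> arcs_ends G"
    proof
      fix e assume "e \<in> set (vwalk_arcs (path x))"
      then obtain i where i: "Suc i < length (path x)" "e = (path x ! i, path x ! Suc i)"
        unfolding set_vwalk_arcs by blast
      then have il: "i < len x" unfolding path_def by simp
      have e: "e = ((g ^^ i) x, g ((g ^^ i) x))"
        using i il unfolding path_def by (simp del: upt_Suc)
      have "(g ^^ i) x \<noteq> (g ^^ Suc i) x" using uniq[OF that that, of i "Suc i"] il by auto
      then show "e \<in> arcs_ends G" using e garc[OF nT[OF that il]] by auto
    qed
  qed
  moreover have "set (path x) \<inter> set (path y) = {}" if "x \<in> X" "y \<in> X" "x \<noteq> y" for x y
    using uniq[OF that(1,2)] that(3) unfolding setp by auto
  moreover have "card (path ` X) = card X"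
    using hd by (intro card_image inj_onI) metis
  moreover have "finite X" using X assms(2) finite_subset by blast
  ultimately show ?thesis
    unfolding linked_def using X hd last lenT
    by (intro conjI exI[of _ "path ` X"]) auto
qed

lemma linked_iff_linkable:
  assumes "finite (verts G)"
  shows "linked G X T \<longleftrightarrow> linkable (verts G) T (\<lambda>v. {w. (v, w) \<in> arcs_ends G}) X"
  using linked_imp_linkable linkable_imp_linked assms by blast

section \<open>Representation over the reals\<close>

locale infinite_vector_space = vector_space scale
  for scale :: "'a :: field \<Rightarrow> 'b :: ab_group_add \<Rightarrow> 'b" +
  assumes infinite_scalars: "infinite (UNIV :: 'a set)"
begin

definition free_family :: "('i \<Rightarrow> 'b) \<Rightarrow> 'i set \<Rightarrow> 'b set \<Rightarrow> bool" where
  "free_family \<phi> I W \<longleftrightarrow> inj_on \<phi> I \<and> \<phi> ` I \<inter> W = {} \<and> independent (\<phi> ` I \<union> W)"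

lemma free_family_cong:
  "(\<And>i. i \<in> I \<Longrightarrow> \<phi> i = \<psi> i) \<Longrightarrow> free_family \<phi> I W \<longleftrightarrow> free_family \<psi> I W"
  unfolding free_family_def by (metis (mono_tags, lifting) image_cong inj_on_cong)

lemma free_family_insert:
  assumes "i \<notin> I"
  shows "free_family \<phi> (insert i I) W \<longleftrightarrow> free_family \<phi> I W \<and> \<phi> i \<notin> span (\<phi> ` I \<union> W)"
proof (cases "\<phi> i \<in> \<phi> ` I \<union> W")
  case True
  then have "\<phi> i \<in> span (\<phi> ` I \<union> W)" by (rule span_base)
  moreover have "\<not> free_family \<phi> (insert i I) W"
    using True assms unfolding free_family_def by auto
  ultimately show ?thesis by blast
next
  case False
  then show ?thesis
    using assms unfolding free_family_def by (auto simp: independent_insert)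
qed

lemma free_family_insert_right:
  assumes "w \<notin> W"
  shows "free_family \<phi> I (insert w W) \<longleftrightarrow> free_family \<phi> I W \<and> w \<notin> span (\<phi> ` I \<union> W)"
proof (cases "w \<in> \<phi> ` I")
  case True
  then have "w \<in> span (\<phi> ` I \<union> W)" by (intro span_base) auto
  then show ?thesis using True unfolding free_family_def by auto
next
  case False
  then show ?thesis
    using assms unfolding free_family_def by (auto simp: independent_insert)
qed

lemma avoid_subspaces:
  assumes U: "subspace U" and "finite \<W>"
    and "\<And>W. W \<in> \<W> \<Longrightarrow> subspace W \<and> \<not> U \<subseteq> W"
  shows "\<exists>u\<in>U. \<forall>W\<in>\<W>. u \<notin> W"
  using assms(2,3)
proof (induction \<W> rule: finite_induct)
  case empty
  then show ?case using subspace_0[OF U] by auto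
next
  case (insert W0 \<W>)
  obtain u where u: "u \<in> U" "\<forall>W\<in>\<W>. u \<notin> W" using insert by auto
  obtain w where w: "w \<in> U" "w \<notin> W0" using insert.prems[of W0] by auto
  have sub: "subspace W" if "W \<in> insert W0 \<W>" for W using insert.prems that by blast
  have line: "s = t" if "W \<in> insert W0 \<W>" "u \<notin> W \<or> w \<notin> W" "u + scale s w \<in> W" "u + scale t w \<in> W"
    for W s t
  proof (rule ccontr)
    assume "s \<noteq> t"
    have "(u + scale s w) - (u + scale t w) \<in> W"
      using that sub by (intro subspace_diff) auto
    then have "scale (s - t) w \<in> W" by (simp add: scale_left_diff_distrib)
    from subspace_scale[OF sub[OF that(1)] this, of "1 / (s - t)"]
    have "w \<in> W" using \<open>s \<noteq> t\<close> by simp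
    moreover from this have "u + scale s w - scale s w \<in> W"
      using that sub by (intro subspace_diff subspace_scale) auto
    ultimately show False using that(2) by simp
  qed
  have "finite {t. u + scale t w \<in> W}" if "W \<in> insert W0 \<W>" for W
  proof -
    have "u \<notin> W \<or> w \<notin> W" using that u w by auto
    then have "{t. u + scale t w \<in> W} \<subseteq> {THE t. u + scale t w \<in> W}"
      using line[OF that] by (auto intro!: the_equality[symmetric])
    then show ?thesis using finite_subset by blast
  qed
  then have "finite (\<Union>W\<in>insert W0 \<W>. {t. u + scale t w \<in> W})"
    using insert.hyps by (intro finite_UN_I) auto
  then obtain t where "t \<notin> (\<Union>W\<in>insert W0 \<W>. {t. u + scale t w \<in> W})"
    using ex_new_if_finite[OF infinite_scalars] by blast
  moreover have "u + scale t w \<in> U" using u w U by (intro subspace_add subspace_scale)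
  ultimately show ?case by (intro bexI[of _ "u + scale t w"]) auto
qed

lemma generic_transversal:
  fixes \<beta> :: "'v \<Rightarrow> 'b" and N :: "'i \<Rightarrow> 'v set"
  assumes "finite Y" and V: "finite V"
    and inj: "inj_on \<beta> V" and ind: "independent (\<beta> ` V)"
  shows "\<exists>\<phi>. \<forall>Y'\<subseteq>Y. \<forall>U\<subseteq>V. free_family \<phi> Y' (\<beta> ` U) \<longleftrightarrow>
           (\<exists>m. inj_on m Y' \<and> (\<forall>y\<in>Y'. m y \<in> N y \<inter> V - U))"
  using assms(1)
proof (induction Y rule: finite_induct)
  case empty
  have "independent (\<beta> ` U)" if "U \<subseteq> V" for U
    using ind that by (metis image_mono independent_mono)
  then show ?case by (simp add: free_family_def)
next
  case (insert y Y)
  obtain \<phi>0 where "\<forall>Y'\<subseteq>Y. \<forall>U\<subseteq>V. free_family \<phi>0 Y' (\<beta> ` U) \<longleftrightarrow>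
      (\<exists>m. inj_on m Y' \<and> (\<forall>y\<in>Y'. m y \<in> N y \<inter> V - U))"
    using insert.IH by (rule exE)
  note \<phi>0 = this[rule_format]
  define F where "F = N y \<inter> V"
  define \<W> where "\<W> = {W \<in> (\<lambda>(Y', U). span (\<phi>0 ` Y' \<union> \<beta> ` U)) ` (Pow Y \<times> Pow V). \<not> \<beta> ` F \<subseteq> W}"
  have "finite \<W>" using insert.hyps V unfolding \<W>_def by auto
  moreover have "subspace W \<and> \<not> span (\<beta> ` F) \<subseteq> W" if "W \<in> \<W>" for W
    using that span_superset[of "\<beta> ` F"] unfolding \<W>_def by (auto simp: subspace_span)
  ultimately obtain u where u: "u \<in> span (\<beta> ` F)" "\<forall>W\<in>\<W>. u \<notin> W"
    using avoid_subspaces[OF subspace_span] by metis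
  have gen: "u \<in> span (\<phi>0 ` Y' \<union> \<beta> ` U) \<longleftrightarrow> \<beta> ` F \<subseteq> span (\<phi>0 ` Y' \<union> \<beta> ` U)"
    if "Y' \<subseteq> Y" "U \<subseteq> V" for Y' U
  proof
    assume "u \<in> span (\<phi>0 ` Y' \<union> \<beta> ` U)"
    then have "span (\<phi>0 ` Y' \<union> \<beta> ` U) \<notin> \<W>" using u(2) by blast
    then show "\<beta> ` F \<subseteq> span (\<phi>0 ` Y' \<union> \<beta> ` U)" using that unfolding \<W>_def by auto
  next
    assume "\<beta> ` F \<subseteq> span (\<phi>0 ` Y' \<union> \<beta> ` U)"
    then show "u \<in> span (\<phi>0 ` Y' \<union> \<beta> ` U)"
      using u(1) span_minimal[OF _ subspace_span] by blast
  qed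
  define \<phi> where "\<phi> = \<phi>0(y := u)"
  have eq: "free_family \<phi> Y' W \<longleftrightarrow> free_family \<phi>0 Y' W" if "Y' \<subseteq> Y" for Y' W
    using that insert.hyps by (intro free_family_cong) (auto simp: \<phi>_def)
  have img: "\<phi> ` Y' = \<phi>0 ` Y'" if "Y' \<subseteq> Y" for Y'
    using that insert.hyps by (auto simp: \<phi>_def)
  have "free_family \<phi> Y' (\<beta> ` U) \<longleftrightarrow> (\<exists>m. inj_on m Y' \<and> (\<forall>z\<in>Y'. m z \<in> N z \<inter> V - U))"
    if Y': "Y' \<subseteq> insert y Y" and U: "U \<subseteq> V" for Y' U
  proof (cases "y \<in> Y'")
    case False
    then have "Y' \<subseteq> Y" using Y' by blast
    then show ?thesis using eq \<phi>0 U by simp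
  next
    case True
    define Z where "Z = Y' - {y}"
    have Z: "Z \<subseteq> Y" "y \<notin> Z" "Y' = insert y Z" using True Y' unfolding Z_def by auto
    have "free_family \<phi> Y' (\<beta> ` U) \<longleftrightarrow>
        free_family \<phi>0 Z (\<beta> ` U) \<and> \<not> \<beta> ` F \<subseteq> span (\<phi>0 ` Z \<union> \<beta> ` U)"
      using Z free_family_insert[of y Z \<phi>] eq[OF Z(1)] img[OF Z(1)] gen[OF Z(1) U]
      by (simp add: \<phi>_def)
    also have "\<dots> \<longleftrightarrow> (\<exists>v\<in>F - U. free_family \<phi>0 Z (\<beta> ` insert v U))"
    proof
      assume L: "free_family \<phi>0 Z (\<beta> ` U) \<and> \<not> \<beta> ` F \<subseteq> span (\<phi>0 ` Z \<union> \<beta> ` U)"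
      then obtain v where v: "v \<in> F" "\<beta> v \<notin> span (\<phi>0 ` Z \<union> \<beta> ` U)" by blast
      have vU: "\<beta> v \<notin> \<beta> ` U" using v(2) span_superset[of "\<phi>0 ` Z \<union> \<beta> ` U"] by blast
      then have "v \<notin> U" by blast
      moreover have "free_family \<phi>0 Z (\<beta> ` insert v U)"
        using L v(2) free_family_insert_right[OF vU, of \<phi>0 Z] by simp
      ultimately
      show "\<exists>v\<in>F - U. free_family \<phi>0 Z (\<beta> ` insert v U)" using v by blast
    next
      assume "\<exists>v\<in>F - U. free_family \<phi>0 Z (\<beta> ` insert v U)"
      then obtain v where v: "v \<in> F" "v \<notin> U" "free_family \<phi>0 Z (\<beta> ` insert v U)" by blast
      have vU: "\<beta> v \<notin> \<beta> ` U"
        using v U inj_on_image_mem_iff[OF inj, of v U] unfolding F_def by simp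
      then show "free_family \<phi>0 Z (\<beta> ` U) \<and> \<not> \<beta> ` F \<subseteq> span (\<phi>0 ` Z \<union> \<beta> ` U)"
        using v free_family_insert_right[OF vU, of \<phi>0 Z] by auto
    qed
    also have "\<dots> \<longleftrightarrow> (\<exists>v\<in>F - U. \<exists>m. inj_on m Z \<and> (\<forall>z\<in>Z. m z \<in> N z \<inter> V - insert v U))"
    proof (rule bex_cong[OF refl])
      fix v assume "v \<in> F - U"
      then have "insert v U \<subseteq> V" using U unfolding F_def by blast
      then show "free_family \<phi>0 Z (\<beta> ` insert v U) \<longleftrightarrow>
          (\<exists>m. inj_on m Z \<and> (\<forall>z\<in>Z. m z \<in> N z \<inter> V - insert v U))"
        by (rule \<phi>0[OF Z(1)])
    qed
    also have "\<dots> \<longleftrightarrow> (\<exists>m. inj_on m Y' \<and> (\<forall>z\<in>Y'. m z \<in> N z \<inter> V - U))"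
    proof
      assume "\<exists>v\<in>F - U. \<exists>m. inj_on m Z \<and> (\<forall>z\<in>Z. m z \<in> N z \<inter> V - insert v U)"
      then obtain v m where m: "v \<in> F - U" "inj_on m Z" "\<forall>z\<in>Z. m z \<in> N z \<inter> V - insert v U"
        by blast
      then have "inj_on (m(y := v)) Y'"
        using Z(2) unfolding Z(3) by (auto simp: inj_on_def)
      moreover have "\<forall>z\<in>Y'. (m(y := v)) z \<in> N z \<inter> V - U"
        using m Z unfolding F_def by auto
      ultimately show "\<exists>m. inj_on m Y' \<and> (\<forall>z\<in>Y'. m z \<in> N z \<inter> V - U)" by blast
    next
      assume "\<exists>m. inj_on m Y' \<and> (\<forall>z\<in>Y'. m z \<in> N z \<inter> V - U)"
      then obtain m where m: "inj_on m Y'" "\<forall>z\<in>Y'. m z \<in> N z \<inter> V - U" by blast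
      then have "m y \<in> F - U" "inj_on m Z" "\<forall>z\<in>Z. m z \<in> N z \<inter> V - insert (m y) U"
        using Z unfolding F_def by (auto, metis imageI)
      then show "\<exists>v\<in>F - U. \<exists>m. inj_on m Z \<and> (\<forall>z\<in>Z. m z \<in> N z \<inter> V - insert v U)" by blast
    qed
    finally show ?thesis .
  qed
  then show ?case by blast
qed

end

interpretation poly_vs: infinite_vector_space "smult :: real \<Rightarrow> real poly \<Rightarrow> real poly"
  by unfold_locales (auto simp: smult_add_right smult_add_left infinite_UNIV_char_0)

abbreviation axis_poly :: "nat \<Rightarrow> real poly" where
  "axis_poly \<equiv> monom 1"

lemma inj_axis_poly: "inj axis_poly"
  by (intro injI) (metis coeff_monom one_neq_zero)

lemma independent_axis_poly:
  assumes "finite V"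
  shows "poly_vs.independent (axis_poly ` V)"
  using assms
proof (induction V rule: finite_induct)
  case empty
  show ?case using poly_vs.independent_empty by simp
next
  case (insert v V)
  have "poly_vs.subspace {p :: real poly. coeff p v = 0}"
    by (auto simp: poly_vs.subspace_def)
  moreover have "axis_poly ` V \<subseteq> {p. coeff p v = 0}" using insert.hyps by auto
  ultimately have "poly_vs.span (axis_poly ` V) \<subseteq> {p. coeff p v = 0}"
    by (rule poly_vs.span_minimal[rotated])
  then have "axis_poly v \<notin> poly_vs.span (axis_poly ` V)" by auto
  then show ?case using insert.IH by (simp add: poly_vs.independent_insertI)
qed

lemma linkable_representation:
  assumes V: "finite V"
  shows "\<exists>\<zeta>. finite \<zeta> \<and> (\<forall>X\<subseteq>V. linkable V T out X \<longleftrightarrow>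
     \<zeta> \<inter> axis_poly ` X = {} \<and> poly_vs.independent (\<zeta> \<union> axis_poly ` X))"
proof -
  have "finite (V - T)" using V by simp
  from poly_vs.generic_transversal[OF this V inj_on_subset[OF inj_axis_poly subset_UNIV]
      independent_axis_poly[OF V], of "\<lambda>v. insert v (out v)"]
  obtain \<phi> where "\<forall>Y'\<subseteq>V - T. \<forall>U\<subseteq>V. poly_vs.free_family \<phi> Y' (axis_poly ` U) \<longleftrightarrow>
      (\<exists>m. inj_on m Y' \<and> (\<forall>y\<in>Y'. m y \<in> insert y (out y) \<inter> V - U))"
    by (rule exE)
  note \<phi> = this[rule_format]
  have ff: "linkable V T out X \<longleftrightarrow> poly_vs.free_family \<phi> (V - T) (axis_poly ` X)" if "X \<subseteq> V" for X
  proof -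
    have "(\<forall>v\<in>V - T. g v \<in> V - X \<and> (g v = v \<or> g v \<in> out v)) \<longleftrightarrow>
        (\<forall>y\<in>V - T. g y \<in> insert y (out y) \<inter> V - X)" for g
      by (intro ball_cong refl) auto
    then show ?thesis using that unfolding \<phi>[OF order_refl that] linkable_def by simp
  qed
  have "linkable V T out {}" by (intro linkableI[where g = id]) auto
  then have "inj_on \<phi> (V - T)" unfolding ff[OF empty_subsetI] poly_vs.free_family_def by blast
  then show ?thesis
    using ff V unfolding poly_vs.free_family_def by (intro exI[of _ "\<phi> ` (V - T)"]) auto
qed

locale linkage =
  fixes V T :: "nat set" and out :: "nat \<Rightarrow> nat set"
  assumes finite_V: "finite V"
begin

abbreviation indep :: "nat set \<Rightarrow> bool" where
  "indep \<equiv> linkable V T out"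

definition contracted :: "real poly set" where
  "contracted = (SOME \<zeta>. finite \<zeta> \<and> (\<forall>X\<subseteq>V. indep X \<longleftrightarrow>
     \<zeta> \<inter> axis_poly ` X = {} \<and> poly_vs.independent (\<zeta> \<union> axis_poly ` X)))"

abbreviation spn :: "nat set \<Rightarrow> real poly set" where
  "spn X \<equiv> poly_vs.span (contracted \<union> axis_poly ` X)"

definition cl :: "nat set \<Rightarrow> nat set" where
  "cl X = {x \<in> V. axis_poly x \<in> spn X}"

lemma finite_contracted: "finite contracted"
  and indep_iff: "X \<subseteq> V \<Longrightarrow> indep X \<longleftrightarrow>
     contracted \<inter> axis_poly ` X = {} \<and> poly_vs.independent (contracted \<union> axis_poly ` X)"
  using someI_ex[OF linkable_representation[OF finite_V, of T out]]
  unfolding contracted_def[symmetric] by simp_all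

lemma indep_subset_V: "indep X \<Longrightarrow> X \<subseteq> V"
  unfolding linkable_def by blast

lemma indep_empty: "indep {}"
  by (intro linkableI[where g = id]) auto

lemma subset_cl: "X \<subseteq> V \<Longrightarrow> X \<subseteq> cl X"
  unfolding cl_def by (auto intro: poly_vs.span_base)

lemma spn_subset: "X \<subseteq> cl Y \<Longrightarrow> spn X \<subseteq> spn Y"
  by (rule poly_vs.span_minimal) (auto simp: cl_def poly_vs.subspace_span intro: poly_vs.span_base)

lemma cl_least: "X \<subseteq> cl Y \<Longrightarrow> cl X \<subseteq> cl Y"
  using spn_subset unfolding cl_def by blast

lemma cl_mono: "X \<subseteq> Y \<Longrightarrow> cl X \<subseteq> cl Y"
  unfolding cl_def using poly_vs.span_mono[of "contracted \<union> axis_poly ` X" "contracted \<union> axis_poly ` Y"]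
  by blast

lemma cl_exchange:
  assumes "x \<in> cl (insert y X)" "x \<notin> cl X" "y \<in> V"
  shows "y \<in> cl (insert x X)"
  using assms poly_vs.in_span_insert[of "axis_poly x" "axis_poly y" "contracted \<union> axis_poly ` X"]
  unfolding cl_def by auto

lemma indep_insert_iff:
  assumes "x \<in> V" "x \<notin> X"
  shows "indep (insert x X) \<longleftrightarrow> indep X \<and> x \<notin> cl X"
proof (cases "X \<subseteq> V")
  case True
  have "axis_poly x \<notin> axis_poly ` X" using assms(2) inj_axis_poly by (auto dest: injD)
  then show ?thesis
    using assms True indep_iff[OF True] indep_iff[of "insert x X"]
    by (auto simp: cl_def poly_vs.independent_insert intro: poly_vs.span_base)
next
  case False
  then show ?thesis using indep_subset_V by blast
qed

lemma cl_iff_indep: "indep X \<Longrightarrow> x \<in> V \<Longrightarrow> x \<in> cl X \<longleftrightarrow> x \<in> X \<or> \<not> indep (insert x X)"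
  using subset_cl[OF indep_subset_V] indep_insert_iff by blast

lemma card_indep_le:
  assumes "indep X" "X \<subseteq> cl Y" "Y \<subseteq> V"
  shows "card X \<le> card Y"
proof -
  have X: "X \<subseteq> V" using assms(1) indep_subset_V by blast
  have fin: "finite X" "finite Y" using X assms(3) finite_V finite_subset by blast+
  have "card (contracted \<union> axis_poly ` X) \<le> card (contracted \<union> axis_poly ` Y)"
    using assms fin finite_contracted X indep_iff[OF X]
      poly_vs.independent_span_bound[of "contracted \<union> axis_poly ` Y" "contracted \<union> axis_poly ` X"]
    by (auto simp: cl_def intro: poly_vs.span_base)
  also have "\<dots> \<le> card contracted + card (axis_poly ` Y)" by (rule card_Un_le)
  also have "\<dots> \<le> card contracted + card Y" using fin(2) by (simp add: card_image_le)
  finally show ?thesis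
    using assms(1) fin finite_contracted indep_iff[OF X]
      card_image[OF inj_on_subset[OF inj_axis_poly subset_UNIV], of X]
    by (simp add: card_Un_disjoint)
qed

lemma indep_augment:
  assumes "indep X" "indep Y" "card X < card Y"
  shows "\<exists>y\<in>Y - X. indep (insert y X)"
proof (rule ccontr)
  assume "\<not> ?thesis"
  then have "Y \<subseteq> cl X"
    using cl_iff_indep[OF assms(1)] indep_subset_V[OF assms(2)] by blast
  then show False using card_indep_le[OF assms(2) _ indep_subset_V[OF assms(1)]] assms(3) by simp
qed

lemma ex_basis:
  assumes "Y \<subseteq> V"
  obtains Z where "Z \<subseteq> Y" "indep Z" "Y \<subseteq> cl Z"
proof -
  have fin: "finite {Z. Z \<subseteq> Y \<and> indep Z}"
    using finite_subset[OF assms finite_V] by simp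
  have ne: "{Z. Z \<subseteq> Y \<and> indep Z} \<noteq> {}" using indep_empty by blast
  from finite_has_maximal[OF fin ne] obtain Z where Z: "Z \<in> {Z. Z \<subseteq> Y \<and> indep Z}"
    and max: "\<forall>Z'\<in>{Z. Z \<subseteq> Y \<and> indep Z}. Z \<subseteq> Z' \<longrightarrow> Z = Z'"
    by (elim bexE)
  have "y \<in> cl Z" if "y \<in> Y" for y
  proof -
    have "y \<in> Z" if "indep (insert y Z)" using max[rule_format, of "insert y Z"] Z that \<open>y \<in> Y\<close> by auto
    then show ?thesis using cl_iff_indep[of Z y] Z that assms by auto
  qed
  then show ?thesis using Z by (intro that[of Z]) auto
qed

lemma card_indep_le_T:
  assumes "indep X" "T \<subseteq> V"
  shows "card X \<le> card T"
proof -
  obtain g where g: "X \<subseteq> V" "inj_on g (V - T)" "g ` (V - T) \<subseteq> V - X"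
    using assms(1) unfolding linkable_def by blast
  have "card (V - T) \<le> card (V - X)"
    using g finite_V by (metis card_inj_on_le finite_Diff)
  moreover have "card X \<le> card V" "card T \<le> card V" using g assms finite_V by (auto intro: card_mono)
  ultimately show ?thesis
    using g(1) assms(2) finite_V by (simp add: card_Diff_subset finite_subset)
qed

end

definition digraph_gammoid ::
  "nat set \<Rightarrow> nat set \<Rightarrow> (nat \<Rightarrow> nat set) \<Rightarrow> nat set \<Rightarrow> nat pre_matroid" where
  "digraph_gammoid V T out S = \<lparr>ground = S, indep_sets = {X. X \<subseteq> S \<and> linkable V T out X}\<rparr>"

lemma matroid_digraph_gammoid:
  assumes "finite V" "S \<subseteq> V"
  shows "matroid (digraph_gammoid V T out S)"
proof -
  interpret linkage V T out using assms(1) by unfold_locales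
  show ?thesis
  proof
    fix X Y assume XY: "X \<in> indep_sets (digraph_gammoid V T out S)"
      "Y \<in> indep_sets (digraph_gammoid V T out S)" "card X < card Y"
    then show "\<exists>y\<in>Y - X. insert y X \<in> indep_sets (digraph_gammoid V T out S)"
      using indep_augment[of X Y] unfolding digraph_gammoid_def by auto
  qed (use assms finite_subset indep_empty linkable_subset in
      \<open>auto simp: digraph_gammoid_def\<close>)
qed

lemma gammoid_L_eq:
  assumes "finite (pverts G)" "pair_wf_digraph G"
  shows "gammoid_L (with_proj G) S T =
    digraph_gammoid (pverts G) T (\<lambda>v. {w. (v, w) \<in> parcs G}) S"
  using linked_iff_linkable[of "with_proj G"] assms
  unfolding gammoid_L_def restriction_def linkage_matroid_def digraph_gammoid_def by auto

lemma gammoid_digraph_gammoid: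
  assumes "finite V" "T \<subseteq> V" "S \<subseteq> V"
  shows "gammoid (digraph_gammoid V T out S)"
proof -
  define G where "G = \<lparr>pverts = V, parcs = {(v, w). v \<in> V \<and> w \<in> V \<and> w \<in> out v}\<rparr>"
  have "finite (parcs G)"
    using assms(1) by (intro finite_subset[of "parcs G" "V \<times> V"]) (auto simp: G_def)
  then have G: "pair_fin_digraph G" using assms(1) by unfold_locales (auto simp: G_def)
  have "linkable V T (\<lambda>v. {w. (v, w) \<in> parcs G}) X \<longleftrightarrow> linkable V T out X" for X
    unfolding linkable_def by (intro conj_cong refl ex_cong1 ball_cong) (auto simp: G_def)
  then have "gammoid_L (with_proj G) S T = digraph_gammoid V T out S"
    using gammoid_L_eq[of G S T] G assms(1)
    by (simp add: digraph_gammoid_def G_def pair_fin_digraph_def)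
  moreover have "matroid_iso M M" for M :: "nat pre_matroid"
    unfolding matroid_iso_def by (intro exI[of _ id]) auto
  ultimately have "matroid_iso (digraph_gammoid V T out S) (gammoid_L (with_proj G) S T)"
    by simp
  moreover have "S \<subseteq> pverts G" "T \<subseteq> pverts G" using assms by (simp_all add: G_def)
  ultimately show ?thesis
    unfolding gammoid_def using matroid_digraph_gammoid[OF assms(1,3)] G by blast
qed

lemma gammoidE:
  assumes "gammoid M"
  obtains V T out S where "finite V" "T \<subseteq> V" "S \<subseteq> V"
    "matroid_iso M (digraph_gammoid V T out S)"
proof -
  obtain G :: "nat pair_pre_digraph" and S T where G: "pair_fin_digraph G" "S \<subseteq> pverts G"
    "T \<subseteq> pverts G" "matroid_iso M (gammoid_L (with_proj G) S T)"
    using assms unfolding gammoid_def by blast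
  interpret pair_fin_digraph G by (rule G(1))
  show ?thesis
  proof (rule that[OF pair_finite_verts G(3,2)])
    show "matroid_iso M (digraph_gammoid (pverts G) T (\<lambda>v. {w. (v, w) \<in> parcs G}) S)"
      using G(4) unfolding gammoid_L_eq[OF pair_finite_verts pair_wf_digraph_axioms] .
  qed
qed

lemma contraction_singleton:
  assumes "matroid M" "e \<in> ground M"
  shows "contraction M {e} =
    (if {e} \<in> indep_sets M
     then \<lparr>ground = ground M - {e}, indep_sets = {X. X \<subseteq> ground M - {e} \<and> insert e X \<in> indep_sets M}\<rparr>
     else deletion M {e})"
proof -
  interpret matroid M by fact
  have "basis_of M {e} B \<longleftrightarrow> B = (if {e} \<in> indep_sets M then {e} else {})" for B
    using empty_indep unfolding basis_of_def by (auto simp: subset_singleton_iff)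
  then show ?thesis
    unfolding contraction_def deletion_def restriction_def by auto
qed

lemma gammoid_contraction_digraph_gammoid:
  assumes V: "finite V" "T \<subseteq> V" "S \<subseteq> V" and e: "e \<in> S"
  shows "gammoid (contraction (digraph_gammoid V T out S) {e})"
proof (cases "linkable V T out {e}")
  case False
  then have "contraction (digraph_gammoid V T out S) {e} = digraph_gammoid V T out (S - {e})"
    using contraction_singleton[OF matroid_digraph_gammoid[OF V(1,3)], of e] e
    by (auto simp: digraph_gammoid_def deletion_def restriction_def)
  then show ?thesis using gammoid_digraph_gammoid[OF V(1,2), of "S - {e}"] V(3) by auto
next
  case True
  then obtain g where "{e} \<subseteq> V" and g: "inj_on g (V - T)" "\<And>v. v \<in> V - T \<Longrightarrow> g v \<in> V"
    "\<And>v. v \<in> V - T \<Longrightarrow> g v \<notin> {e}" "\<And>v. v \<in> V - T \<Longrightarrow> g v = v \<or> g v \<in> out v"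
    by (rule linkableE) blast
  define V' where "V' = V - {e}"
  define T' where "T' = V' - g ` (V - T)"
  define src where "src = the_inv_into (V - T) g"
  define out' where "out' w = insert (src w) (out (src w))" for w
  have src: "src (g v) = v" if "v \<in> V - T" for v
    using the_inv_into_f_f[OF g(1) that] by (simp add: src_def)
  have dom: "V' - T' = g ` (V - T)" using g(2,3) by (auto simp: T'_def V'_def)
  have iff: "linkable V T out (insert e X) \<longleftrightarrow> linkable V' T' out' X" if X: "X \<subseteq> S - {e}" for X
  proof
    assume "linkable V T out (insert e X)"
    then obtain k where k: "insert e X \<subseteq> V" "inj_on k (V - T)" "\<And>v. v \<in> V - T \<Longrightarrow> k v \<in> V"
      "\<And>v. v \<in> V - T \<Longrightarrow> k v \<notin> insert e X" "\<And>v. v \<in> V - T \<Longrightarrow> k v = v \<or> k v \<in> out v"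
      by (rule linkableE) blast
    show "linkable V' T' out' X"
    proof (rule linkableI[where g = "k \<circ> src"])
      show "X \<subseteq> V'" using X k(1) by (auto simp: V'_def)
      show "inj_on (k \<circ> src) (V' - T')"
        unfolding dom using k(2) src by (auto simp: inj_on_def)
      fix w assume "w \<in> V' - T'"
      then obtain v where v: "v \<in> V - T" "w = g v" unfolding dom by blast
      then show "(k \<circ> src) w \<in> V' - X \<and> ((k \<circ> src) w = w \<or> (k \<circ> src) w \<in> out' w)"
        using src[OF v(1)] k(3-5)[OF v(1)] by (auto simp: V'_def out'_def)
    qed
  next
    assume "linkable V' T' out' X"
    then obtain k where k: "X \<subseteq> V'" "inj_on k (V' - T')" "\<And>v. v \<in> V' - T' \<Longrightarrow> k v \<in> V'"
      "\<And>v. v \<in> V' - T' \<Longrightarrow> k v \<notin> X" "\<And>v. v \<in> V' - T' \<Longrightarrow> k v = v \<or> k v \<in> out' v"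
      by (rule linkableE) blast
    show "linkable V T out (insert e X)"
    proof (rule linkableI[where g = "k \<circ> g"])
      show "insert e X \<subseteq> V" using X e V(3) by auto
      show "inj_on (k \<circ> g) (V - T)" using g(1) k(2) unfolding dom by (rule comp_inj_on)
      fix v assume v: "v \<in> V - T"
      then have "g v \<in> V' - T'" unfolding dom by blast
      from k(3-5)[OF this] show "(k \<circ> g) v \<in> V - insert e X \<and> ((k \<circ> g) v = v \<or> (k \<circ> g) v \<in> out v)"
        using g(4)[OF v] src[OF v] by (auto simp: V'_def out'_def)
    qed
  qed
  have "contraction (digraph_gammoid V T out S) {e} = digraph_gammoid V' T' out' (S - {e})"
    using contraction_singleton[OF matroid_digraph_gammoid[OF V(1,3)], of e] e True iff V(3)
    by (auto simp: digraph_gammoid_def)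
  moreover have "gammoid (digraph_gammoid V' T' out' (S - {e}))"
    using V by (intro gammoid_digraph_gammoid) (auto simp: V'_def T'_def)
  ultimately show ?thesis by simp
qed

section \<open>Vertices without in-arcs\<close>

lemma linkable_upd_irrelevant:
  assumes y: "y \<notin> X" and no_in: "\<And>v. v \<in> V \<Longrightarrow> v \<noteq> y \<Longrightarrow> y \<notin> out v"
    and "linkable V T out X"
  shows "linkable V T (out(y := F)) X"
proof -
  obtain g where X: "X \<subseteq> V" and g: "inj_on g (V - T)"
    "\<forall>v\<in>V - T. g v \<in> V - X \<and> (g v = v \<or> g v \<in> out v)"
    using assms(3) unfolding linkable_def by (elim conjE exE)
  have gy: "g v \<noteq> y" if "v \<in> V - T" "v \<noteq> y" for v
    using g(2)[rule_format, OF that(1)] no_in[of v] that by auto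
  show ?thesis
  proof (rule linkableI[where g = "g(y := y)", OF X])
    show "inj_on (g(y := y)) (V - T)"
      using g(1) gy unfolding inj_on_def by (auto simp: fun_upd_apply)
    show "(g(y := y)) v \<in> V - X \<and> ((g(y := y)) v = v \<or> (g(y := y)) v \<in> (out(y := F)) v)"
      if "v \<in> V - T" for v
      using g(2)[rule_format, OF that] that y by (cases "v = y") simp_all
  qed
qed

lemma linkable_upd_iff:
  assumes "y \<notin> X" "\<And>v. v \<in> V \<Longrightarrow> v \<noteq> y \<Longrightarrow> y \<notin> out v"
  shows "linkable V T (out(y := F)) X \<longleftrightarrow> linkable V T out X"
  using linkable_upd_irrelevant[OF assms, where T = T and F = F]
    linkable_upd_irrelevant[OF assms(1), where V = V and T = T and out = "out(y := F)" and F = "out y"]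
    assms(2) by auto

lemma linkable_insert_source:
  assumes y: "y \<in> V - T" "y \<notin> X" and no_in: "\<And>v. v \<in> V \<Longrightarrow> v \<noteq> y \<Longrightarrow> y \<notin> out v"
    and F: "F \<subseteq> V" "y \<notin> F"
  shows "linkable V T (out(y := F)) (insert y X) \<longleftrightarrow> (\<exists>f\<in>F - X. linkable V T out (insert f X))"
proof
  assume "linkable V T (out(y := F)) (insert y X)"
  then obtain g where X: "insert y X \<subseteq> V" and g: "inj_on g (V - T)"
    "\<forall>v\<in>V - T. g v \<in> V - insert y X \<and> (g v = v \<or> g v \<in> (out(y := F)) v)"
    unfolding linkable_def by (elim conjE exE)
  have gF: "g y \<in> F" "g y \<notin> X" using g(2)[rule_format, OF y(1)] by auto
  have ne: "g v \<noteq> g y" if "v \<in> V - T" "v \<noteq> y" for v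
    using inj_onD[OF g(1) _ that(1) y(1)] that(2) by auto
  have "linkable V T out (insert (g y) X)"
  proof (rule linkableI[where g = "g(y := y)"])
    show "insert (g y) X \<subseteq> V" using X gF F by auto
    have "g v \<noteq> y" if "v \<in> V - T" for v using g(2)[rule_format, OF that] by auto
    then show "inj_on (g(y := y)) (V - T)"
      using g(1) unfolding inj_on_def by (auto simp: fun_upd_apply)
    show "(g(y := y)) v \<in> V - insert (g y) X \<and> ((g(y := y)) v = v \<or> (g(y := y)) v \<in> out v)"
      if "v \<in> V - T" for v
      using g(2)[rule_format, OF that] that y gF F ne[OF that] by (cases "v = y") auto
  qed
  then show "\<exists>f\<in>F - X. linkable V T out (insert f X)" using gF by blast
next
  assume "\<exists>f\<in>F - X. linkable V T out (insert f X)"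
  then obtain f where f: "f \<in> F" "f \<notin> X" "linkable V T out (insert f X)" by blast
  obtain g where X: "insert f X \<subseteq> V" and g: "inj_on g (V - T)"
    "\<forall>v\<in>V - T. g v \<in> V - insert f X \<and> (g v = v \<or> g v \<in> out v)"
    using f(3) unfolding linkable_def by (elim conjE exE)
  show "linkable V T (out(y := F)) (insert y X)"
  proof (rule linkableI[where g = "g(y := f)"])
    show "insert y X \<subseteq> V" using X y by auto
    have "g v \<noteq> f" if "v \<in> V - T" for v using g(2)[rule_format, OF that] by auto
    then show "inj_on (g(y := f)) (V - T)"
      using g(1) unfolding inj_on_def by (auto simp: fun_upd_apply)
    show "(g(y := f)) v \<in> V - insert y X \<and> ((g(y := f)) v = v \<or> (g(y := f)) v \<in> (out(y := F)) v)"
      if "v \<in> V - T" for v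
    proof (cases "v = y")
      case True
      then show ?thesis using f F by auto
    next
      case False
      then show ?thesis using g(2)[rule_format, OF that] no_in[of v] that by auto
    qed
  qed
qed

context linkage
begin

lemma indep_insert_not_cl: "indep (insert x X) \<Longrightarrow> x \<notin> X \<Longrightarrow> x \<notin> cl X"
  using indep_insert_iff[of x X] indep_subset_V[of "insert x X"] by auto

lemma indep_insert_source_iff:
  assumes y: "y \<in> V - T" "y \<notin> X" and no_in: "\<And>v. v \<in> V \<Longrightarrow> v \<noteq> y \<Longrightarrow> y \<notin> out v"
    and F: "F \<subseteq> V" "y \<notin> F"
  shows "linkable V T (out(y := F)) (insert y X) \<longleftrightarrow> indep X \<and> \<not> F \<subseteq> cl X"
proof (cases "X \<subseteq> V")
  case True
  have "(\<exists>f\<in>F - X. indep (insert f X)) \<longleftrightarrow> indep X \<and> \<not> F \<subseteq> cl X"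
    using indep_insert_iff[of _ X] subset_cl[OF True] F(1) by blast
  then show ?thesis using linkable_insert_source[where F = F, OF y no_in F] by simp
next
  case False
  then show ?thesis by (auto simp: linkable_def)
qed

lemma source_mem_cl_iff:
  assumes y: "y \<in> V - T" "y \<notin> X" and no_in: "\<And>v. v \<in> V \<Longrightarrow> y \<notin> out v"
    and out: "out y \<subseteq> V" and X: "X \<subseteq> V"
  shows "y \<in> cl X \<longleftrightarrow> out y \<subseteq> cl X"
proof -
  obtain Z where Z: "Z \<subseteq> X" "indep Z" "X \<subseteq> cl Z" using ex_basis[OF X] .
  have eq: "cl X = cl Z" using cl_least[OF Z(3)] cl_mono[OF Z(1)] by blast
  have yZ: "y \<notin> Z" using y(2) Z(1) by blast
  have yo: "y \<notin> out y" using no_in y(1) by blast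
  have "indep (insert y Z) \<longleftrightarrow> \<not> out y \<subseteq> cl Z"
    using indep_insert_source_iff[where F = "out y", OF y(1) yZ no_in out yo] Z(2) by simp
  then show ?thesis using indep_insert_iff[OF _ yZ] y(1) Z(2) unfolding eq by blast
qed

lemma spanning_if_card:
  assumes "T \<subseteq> V" "indep Y" "indep Z" "Z \<subseteq> cl Y" "card T \<le> card Z"
  shows "V \<subseteq> cl Y"
proof
  fix v assume v: "v \<in> V"
  have YV: "Y \<subseteq> V" using assms(2) by (rule indep_subset_V)
  have "card Z \<le> card Y" by (rule card_indep_le[OF assms(3,4) YV])
  moreover have "finite Y" using YV finite_V finite_subset by blast
  ultimately have "\<not> indep (insert v Y)" if "v \<notin> Y"
    using card_indep_le_T[of "insert v Y"] that assms(1,5) by auto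
  then show "v \<in> cl Y" using cl_iff_indep[OF assms(2) v] by blast
qed

text \<open>
  Ingleton's obstruction: the spans of \<open>P\<close>, \<open>Q\<close>, \<open>R\<close> all meet the line \<open>xy\<close>, and, by the
  assumptions on \<open>x\<close>, in the same vector \<open>y - k x\<close>, which is then common to the spans of \<open>Q\<close> and \<open>R\<close>.
\<close>

lemma common_point_dependent:
  assumes V: "x \<in> V" "y \<in> V" "P \<subseteq> V" "Q \<subseteq> V" "R \<subseteq> V"
    and xy: "y \<notin> cl {x}" and y_cl: "y \<in> cl (insert x P)" "y \<in> cl (insert x Q)" "y \<in> cl (insert x R)"
    and x_ncl: "x \<notin> cl (P \<union> Q)" "x \<notin> cl (P \<union> R)" and disj: "Q \<inter> R = {}"
  shows "\<not> indep (Q \<union> R)"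
proof
  assume ind: "indep (Q \<union> R)"
  let ?x = "axis_poly x" and ?y = "axis_poly y"
  have ex: "\<exists>k. ?y - smult k ?x \<in> spn Z" if "y \<in> cl (insert x Z)" for Z
    using that poly_vs.span_breakdown_eq[of ?y ?x "contracted \<union> axis_poly ` Z"]
    unfolding cl_def by simp
  obtain k where k: "?y - smult k ?x \<in> spn P" using ex[OF y_cl(1)] by blast
  obtain l where l: "?y - smult l ?x \<in> spn Q" using ex[OF y_cl(2)] by blast
  obtain m where m: "?y - smult m ?x \<in> spn R" using ex[OF y_cl(3)] by blast
  have same: "s = t" if st: "?y - smult s ?x \<in> spn Z" "?y - smult t ?x \<in> spn W" "x \<notin> cl (Z \<union> W)"
    for s t Z W
  proof (rule ccontr)
    assume "s \<noteq> t"
    have "?y - smult s ?x \<in> spn (Z \<union> W)" "?y - smult t ?x \<in> spn (Z \<union> W)"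
      using st(1,2) poly_vs.span_mono[of "contracted \<union> axis_poly ` Z" "contracted \<union> axis_poly ` (Z \<union> W)"]
        poly_vs.span_mono[of "contracted \<union> axis_poly ` W" "contracted \<union> axis_poly ` (Z \<union> W)"] by blast+
    then have "(?y - smult s ?x) - (?y - smult t ?x) \<in> spn (Z \<union> W)" by (rule poly_vs.span_diff)
    moreover have "(?y - smult s ?x) - (?y - smult t ?x) = smult (t - s) ?x"
      by (simp add: smult_diff_left)
    ultimately have "smult (1 / (t - s)) (smult (t - s) ?x) \<in> spn (Z \<union> W)"
      by (metis poly_vs.span_scale)
    then have "?x \<in> spn (Z \<union> W)" using \<open>s \<noteq> t\<close> by simp
    then show False using st(3) V(1) unfolding cl_def by blast
  qed
  have "k = l" "k = m" using same[OF k l x_ncl(1)] same[OF k m x_ncl(2)] by blast+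
  define p where "p = ?y - smult k ?x"
  have pQ: "p \<in> spn Q" and pR: "p \<in> spn R" using l m \<open>k = l\<close> \<open>k = m\<close> unfolding p_def by simp_all
  have fin: "finite {Z. Z \<subseteq> Q \<and> p \<in> spn Z}" using finite_subset[OF V(4) finite_V] by simp
  have ne: "{Z. Z \<subseteq> Q \<and> p \<in> spn Z} \<noteq> {}" using pQ by blast
  from finite_has_minimal[OF fin ne] obtain Z where Z: "Z \<in> {Z. Z \<subseteq> Q \<and> p \<in> spn Z}"
    and min: "\<forall>Z'\<in>{Z. Z \<subseteq> Q \<and> p \<in> spn Z}. Z' \<subseteq> Z \<longrightarrow> Z = Z'" by (elim bexE)
  show False
  proof (cases "Z = {}")
    case True
    then have "?y - smult k ?x \<in> poly_vs.span (contracted \<union> axis_poly ` {})"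
      using Z unfolding p_def by simp
    then have "?y \<in> spn {x}"
      using poly_vs.span_breakdown_eq[of ?y ?x "contracted \<union> axis_poly ` {}"] by auto
    then show False using xy V(2) unfolding cl_def by blast
  next
    case False
    then obtain z where z: "z \<in> Z" by blast
    let ?S = "contracted \<union> axis_poly ` (Z - {z})"
    have "p \<notin> poly_vs.span ?S"
    proof
      assume "p \<in> poly_vs.span ?S"
      then have "Z = Z - {z}" using Z by (intro min[rule_format]) auto
      then show False using z by blast
    qed
    moreover have "p \<in> poly_vs.span (insert (axis_poly z) ?S)"
    proof -
      have "insert (axis_poly z) ?S = contracted \<union> axis_poly ` Z" using z by auto
      then show ?thesis using Z by simp
    qed
    ultimately have "axis_poly z \<in> poly_vs.span (insert p ?S)" by (rule poly_vs.in_span_insert[rotated])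
    moreover have "poly_vs.span (insert p ?S) \<subseteq> spn ((Q \<union> R) - {z})"
    proof (rule poly_vs.span_minimal)
      have "z \<notin> R" using z Z disj by auto
      then have "contracted \<union> axis_poly ` R \<subseteq> contracted \<union> axis_poly ` ((Q \<union> R) - {z})" by auto
      then have "p \<in> spn ((Q \<union> R) - {z})" using pR poly_vs.span_mono by blast
      moreover have "?S \<subseteq> contracted \<union> axis_poly ` ((Q \<union> R) - {z})" using Z by auto
      ultimately show "insert p ?S \<subseteq> spn ((Q \<union> R) - {z})"
        using poly_vs.span_superset[of "contracted \<union> axis_poly ` ((Q \<union> R) - {z})"] by blast
    qed (rule poly_vs.subspace_span)
    ultimately have "z \<in> cl ((Q \<union> R) - {z})" using z Z V(4) unfolding cl_def by auto
    moreover have "insert z ((Q \<union> R) - {z}) = Q \<union> R" using z Z by auto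
    ultimately show False using indep_insert_iff[of z "(Q \<union> R) - {z}"] ind z Z V(4) by auto
  qed
qed

end

section \<open>The circuit-hyperplane and its relaxation\<close>

locale gadget = linkage V T out
  for V T :: "nat set" and out :: "nat \<Rightarrow> nat set" +
  fixes p a a1 a2 b c d :: nat and B C D :: "nat set"
  assumes T_V: "T \<subseteq> V"
    and elems_V: "{p, a, a1, a2, b, c, d} \<union> B \<union> C \<union> D \<subseteq> V"
    and distinct_elems: "distinct [p, a, a1, a2, b, c, d]"
    and disjoint: "{p, a, a1, a2, b, c, d} \<inter> (B \<union> C \<union> D) = {}"
      "B \<inter> C = {}" "B \<inter> D = {}" "C \<inter> D = {}"
    and sources: "{a1, a2, b, c, d} \<inter> T = {}"
      "\<And>v. v \<in> V \<Longrightarrow> out v \<inter> {a1, a2, b, c, d} = {}"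
    and out_sources: "out a1 = {p, a}" "out a2 = {p, a}"
      "out b = insert p B" "out c = insert p C" "out d = insert p D"
    and cards: "card C = card B" "card D = card B" "card T = 2 * card B + 2" "B \<noteq> {}"
    and coloop: "\<And>X. indep X \<Longrightarrow> X \<inter> {a1, a2, b, c, d} = {} \<Longrightarrow> indep (insert p X)"
    and generic: "\<And>X k. k \<in> B \<union> C \<union> D \<Longrightarrow> k \<notin> X \<Longrightarrow> X \<inter> {a1, a2, b, c, d} = {} \<Longrightarrow>
      indep (insert k X) \<Longrightarrow> indep (insert a X)"
    and bases: "\<And>x. x \<in> D \<Longrightarrow> indep (insert p (insert x (B \<union> C)))"
      "\<And>x. x \<in> C \<Longrightarrow> indep (insert p (insert x (B \<union> D)))"
      "\<And>x. x \<in> B \<Longrightarrow> indep (insert p (insert x (C \<union> D)))"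
begin

lemma swap_B_C: "gadget V T out p a a1 a2 c b d C B D"
proof unfold_locales
  show "T \<subseteq> V" by (rule T_V)
  show "{p, a, a1, a2, c, b, d} \<union> C \<union> B \<union> D \<subseteq> V" using elems_V by auto
  show "distinct [p, a, a1, a2, c, b, d]" using distinct_elems by auto
  show "{p, a, a1, a2, c, b, d} \<inter> (C \<union> B \<union> D) = {}" using disjoint by auto
  show "C \<inter> B = {}" "C \<inter> D = {}" "B \<inter> D = {}" using disjoint by auto
  show "{a1, a2, c, b, d} \<inter> T = {}" using sources by auto
  show "out v \<inter> {a1, a2, c, b, d} = {}" if "v \<in> V" for v using sources(2)[OF that] by auto
  show "out a1 = {p, a}" "out a2 = {p, a}" "out c = insert p C" "out b = insert p B"
    "out d = insert p D" by (fact out_sources)+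
  show "card B = card C" "card D = card C" "card T = 2 * card C + 2" using cards by simp_all
  show "C \<noteq> {}" using cards finite_subset[OF _ finite_V, of B] elems_V by (metis card_0_eq card.empty Un_subset_iff)
  show "indep (insert p X)" if "indep X" "X \<inter> {a1, a2, c, b, d} = {}" for X
    using coloop[OF that(1)] that(2) by auto
  show "indep (insert a X)" if "k \<in> C \<union> B \<union> D" "k \<notin> X" "X \<inter> {a1, a2, c, b, d} = {}"
    "indep (insert k X)" for X k
    using generic[of k X] that by auto
  show "indep (insert p (insert x (C \<union> B)))" if "x \<in> D" for x
    using bases(1)[OF that] by (simp add: Un_commute)
  show "indep (insert p (insert x (C \<union> D)))" if "x \<in> B" for x by (rule bases(3)[OF that])
  show "indep (insert p (insert x (B \<union> D)))" if "x \<in> C" for x by (rule bases(2)[OF that])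
qed

lemma swap_C_D: "gadget V T out p a a1 a2 b d c B D C"
proof unfold_locales
  show "T \<subseteq> V" by (rule T_V)
  show "{p, a, a1, a2, b, d, c} \<union> B \<union> D \<union> C \<subseteq> V" using elems_V by auto
  show "distinct [p, a, a1, a2, b, d, c]" using distinct_elems by auto
  show "{p, a, a1, a2, b, d, c} \<inter> (B \<union> D \<union> C) = {}" using disjoint by auto
  show "B \<inter> D = {}" "B \<inter> C = {}" "D \<inter> C = {}" using disjoint by auto
  show "{a1, a2, b, d, c} \<inter> T = {}" using sources by auto
  show "out v \<inter> {a1, a2, b, d, c} = {}" if "v \<in> V" for v using sources(2)[OF that] by auto
  show "out a1 = {p, a}" "out a2 = {p, a}" "out b = insert p B" "out d = insert p D"
    "out c = insert p C" by (fact out_sources)+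
  show "card D = card B" "card C = card B" "card T = 2 * card B + 2" "B \<noteq> {}" by (fact cards)+
  show "indep (insert p X)" if "indep X" "X \<inter> {a1, a2, b, d, c} = {}" for X
    using coloop[OF that(1)] that(2) by auto
  show "indep (insert a X)" if "k \<in> B \<union> D \<union> C" "k \<notin> X" "X \<inter> {a1, a2, b, d, c} = {}"
    "indep (insert k X)" for X k
    using generic[of k X] that by auto
  show "indep (insert p (insert x (B \<union> D)))" if "x \<in> C" for x by (rule bases(2)[OF that])
  show "indep (insert p (insert x (B \<union> C)))" if "x \<in> D" for x by (rule bases(1)[OF that])
  show "indep (insert p (insert x (D \<union> C)))" if "x \<in> B" for x
    using bases(3)[OF that] by (simp add: Un_commute)
qed

abbreviation "elems \<equiv> {a1, a2, b, c, d} \<union> B \<union> C \<union> D"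

abbreviation "hyperplane \<equiv> {c, d} \<union> C \<union> D"

lemma elems_subset_V: "elems \<subseteq> V"
  using elems_V by blast

lemma finite_parts: "finite B" "finite C" "finite D"
  using elems_V finite_subset[OF _ finite_V] by (simp_all add: le_sup_iff)

lemma source_cl_iff:
  assumes "y \<in> {a1, a2, b, c, d}" "y \<notin> X" "X \<subseteq> V"
  shows "y \<in> cl X \<longleftrightarrow> out y \<subseteq> cl X"
proof (rule source_mem_cl_iff)
  show "y \<in> V - T" using assms(1) elems_V sources(1) by blast
  show "y \<notin> out v" if "v \<in> V" for v using sources(2)[OF that] assms(1) by blast
  show "out y \<subseteq> V" using assms(1) elems_V out_sources by auto
qed (use assms in auto)

lemma coloop_cl:
  assumes "X \<subseteq> V" "p \<notin> X" "X \<inter> {a1, a2, b, c, d} = {}"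
  shows "p \<notin> cl X"
proof
  assume p: "p \<in> cl X"
  obtain Z where Z: "Z \<subseteq> X" "indep Z" "X \<subseteq> cl Z" using ex_basis[OF assms(1)] .
  have "indep (insert p Z)" using coloop[OF Z(2)] Z(1) assms(3) by blast
  moreover have "p \<notin> Z" using Z(1) assms(2) by auto
  ultimately have "p \<notin> cl Z" by (rule indep_insert_not_cl)
  then show False using p cl_least[OF Z(3)] by blast
qed

lemma generic_cl:
  assumes "X \<subseteq> V" "a \<notin> X" "X \<inter> {a1, a2, b, c, d} = {}" "a \<in> cl X"
  shows "B \<union> C \<union> D \<subseteq> cl X"
proof
  fix k assume k: "k \<in> B \<union> C \<union> D"
  obtain Z where Z: "Z \<subseteq> X" "indep Z" "X \<subseteq> cl Z" using ex_basis[OF assms(1)] .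
  have eq: "cl X = cl Z" using cl_least[OF Z(3)] cl_mono[OF Z(1)] by (rule equalityI)
  show "k \<in> cl X"
  proof (rule ccontr)
    assume "k \<notin> cl X"
    then have kZ: "k \<notin> cl Z" using eq by simp
    have kV: "k \<in> V" using k elems_V by auto
    have "k \<notin> Z" using kZ subset_cl[OF indep_subset_V[OF Z(2)]] by blast
    then have "indep (insert a Z)"
      using generic[OF k] indep_insert_iff[OF kV] kZ Z(1,2) assms(3) by blast
    moreover have "a \<notin> Z" using Z(1) assms(2) by auto
    ultimately have "a \<notin> cl Z" by (rule indep_insert_not_cl)
    then show False using assms(4) eq by simp
  qed
qed

lemma indep_p_C_D: "indep (insert p (C \<union> D))"
  using cards(4) bases(3) linkable_subset by (meson equals0I insert_mono subset_insertI)

lemma p_C_D_V: "insert p (C \<union> D) \<subseteq> V"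
  using elems_V by auto

lemma card_p_C_D: "card (insert p (C \<union> D)) = 2 * card B + 1"
proof -
  have "p \<notin> C \<union> D" using disjoint by auto
  then show ?thesis
    using cards finite_parts disjoint by (simp add: card_Un_disjoint)
qed

lemma card_hyperplane_minus_d: "card (insert c (C \<union> D)) = 2 * card B + 1"
proof -
  have "c \<notin> C \<union> D" using disjoint by auto
  then show ?thesis
    using cards finite_parts disjoint by (simp add: card_Un_disjoint)
qed

lemma card_hyperplane: "card hyperplane = 2 * card B + 2"
proof -
  have "d \<notin> insert c (C \<union> D)" using disjoint distinct_elems by auto
  then have "card (insert d (insert c (C \<union> D))) = 2 * card B + 2"
    using card_hyperplane_minus_d finite_parts by simp
  moreover have "insert d (insert c (C \<union> D)) = hyperplane" by auto
  ultimately show ?thesis by simp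
qed

lemma nmem_cl_p_C_D:
  shows "x \<in> B \<Longrightarrow> x \<notin> cl (insert p (C \<union> D))" "a \<notin> cl (insert p (C \<union> D))"
    "x \<in> {a1, a2, b} \<Longrightarrow> x \<notin> cl (insert p (C \<union> D))"
proof -
  let ?F = "insert p (C \<union> D)"
  have dist: "B \<inter> ?F = {}" "a \<notin> ?F" "{a1, a2, b, c, d} \<inter> ?F = {}"
    using disjoint distinct_elems by auto
  have B: "x \<notin> cl ?F" if "x \<in> B" for x
  proof -
    have "indep (insert x ?F)" using bases(3)[OF that] by (simp add: insert_commute)
    moreover have "x \<notin> ?F" using that dist by auto
    ultimately show ?thesis by (rule indep_insert_not_cl)
  qed
  then show "x \<in> B \<Longrightarrow> x \<notin> cl ?F" .
  obtain k where k: "k \<in> B" using cards(4) by blast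
  show a: "a \<notin> cl ?F"
  proof
    assume "a \<in> cl ?F"
    then have "B \<union> C \<union> D \<subseteq> cl ?F" using dist by (intro generic_cl[OF p_C_D_V]) auto
    then show False using B[OF k] k by blast
  qed
  show "x \<notin> cl ?F" if x: "x \<in> {a1, a2, b}"
  proof
    assume "x \<in> cl ?F"
    then have "out x \<subseteq> cl ?F" using source_cl_iff[OF _ _ p_C_D_V, of x] x dist by blast
    then show False using x a B[OF k] k out_sources by auto
  qed
qed

lemma hyperplane_subset_cl: "hyperplane \<subseteq> cl (insert p (C \<union> D))"
proof -
  have *: "insert p (C \<union> D) \<subseteq> cl (insert p (C \<union> D))" by (rule subset_cl[OF p_C_D_V])
  have "c \<notin> insert p (C \<union> D)" "d \<notin> insert p (C \<union> D)"
    using disjoint distinct_elems by auto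
  then have "c \<in> cl (insert p (C \<union> D))" "d \<in> cl (insert p (C \<union> D))"
    using source_cl_iff[OF _ _ p_C_D_V, of c] source_cl_iff[OF _ _ p_C_D_V, of d] out_sources *
    by auto
  then show ?thesis using * by auto
qed

lemma hyperplane_dependent: "\<not> indep hyperplane"
  using card_indep_le[OF _ hyperplane_subset_cl p_C_D_V] card_hyperplane card_p_C_D by auto

lemma indep_hyperplane_minus_d: "indep (insert c (C \<union> D))"
proof -
  have "indep (C \<union> D)" using indep_p_C_D linkable_subset by blast
  moreover have CD: "C \<union> D \<subseteq> V" "c \<notin> C \<union> D" "c \<in> V" using elems_V disjoint by auto
  moreover have "p \<notin> cl (C \<union> D)" using CD disjoint by (intro coloop_cl) auto
  then have "c \<notin> cl (C \<union> D)" using source_cl_iff[of c "C \<union> D"] CD out_sources by auto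
  ultimately show ?thesis using indep_insert_iff[of c "C \<union> D"] by simp
qed

lemma p_C_D_cases:
  assumes Y: "Y \<subseteq> elems - {d}" "indep Y" and cl: "insert p (C \<union> D) \<subseteq> cl Y"
  shows "Y = insert c (C \<union> D) \<or> V \<subseteq> cl Y"
proof (cases "Y \<subseteq> cl (insert p (C \<union> D))")
  case True
  have "Y \<subseteq> insert c (C \<union> D)"
    using True Y(1) nmem_cl_p_C_D by auto
  moreover have "card (insert c (C \<union> D)) \<le> card Y"
    using card_indep_le[OF indep_p_C_D cl indep_subset_V[OF Y(2)]]
    by (simp only: card_p_C_D card_hyperplane_minus_d)
  ultimately show ?thesis
    using card_subset_eq[of "insert c (C \<union> D)" Y] card_mono[of "insert c (C \<union> D)" Y] finite_parts
    by (simp add: card_seteq)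
next
  case False
  then obtain y where y: "y \<in> Y" "y \<notin> cl (insert p (C \<union> D))" by blast
  have yF: "y \<notin> insert p (C \<union> D)" using y(2) subset_cl[OF p_C_D_V] by blast
  have YV: "Y \<subseteq> V" by (rule indep_subset_V[OF Y(2)])
  have "indep (insert y (insert p (C \<union> D)))"
    using indep_insert_iff[OF _ yF] y YV indep_p_C_D by blast
  moreover have "insert y (insert p (C \<union> D)) \<subseteq> cl Y" using cl y(1) subset_cl[OF YV] by blast
  moreover have "card T \<le> card (insert y (insert p (C \<union> D)))"
    using yF cards(3) card_p_C_D finite_parts by (simp del: insert_iff)
  ultimately show ?thesis using spanning_if_card[OF T_V Y(2)] by blast
qed

text \<open>
  A minimal set spanning \<open>p\<close> contains a source, and each of its sources \<open>y\<close>, being placed freely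
  on \<^term>\<open>out y\<close>, can only contribute if the rest spans \<^term>\<open>out y\<close>.
\<close>

lemma ex_minimal_spanning_p:
  assumes Y: "Y \<subseteq> elems" "p \<in> cl Y"
  obtains Z where "Z \<subseteq> Y" "Z \<inter> {a1, a2, b, c, d} \<noteq> {}" "p \<in> cl Z"
    "\<And>y. y \<in> Z \<Longrightarrow> y \<in> {a1, a2, b, c, d} \<Longrightarrow> out y \<subseteq> cl (insert p (Z - {y}))"
proof -
  have YV: "Y \<subseteq> V" using Y(1) elems_V by auto
  have fin: "finite {Z. Z \<subseteq> Y \<and> p \<in> cl Z}" using finite_subset[OF YV finite_V] by simp
  have ne: "{Z. Z \<subseteq> Y \<and> p \<in> cl Z} \<noteq> {}" using Y(2) by blast
  from finite_has_minimal[OF fin ne] obtain Z where Z: "Z \<in> {Z. Z \<subseteq> Y \<and> p \<in> cl Z}"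
    and min: "\<forall>Z'\<in>{Z. Z \<subseteq> Y \<and> p \<in> cl Z}. Z' \<subseteq> Z \<longrightarrow> Z = Z'" by (elim bexE)
  have ZY: "Z \<subseteq> Y" and pZ: "p \<in> cl Z" using Z by auto
  have pY: "p \<notin> Y" using Y(1) disjoint distinct_elems by auto
  show ?thesis
  proof (rule that[OF ZY _ pZ])
    show "Z \<inter> {a1, a2, b, c, d} \<noteq> {}"
      using coloop_cl[of Z] pZ pY ZY YV by blast
    fix y assume y: "y \<in> Z" "y \<in> {a1, a2, b, c, d}"
    have p_ncl: "p \<notin> cl (Z - {y})"
    proof
      assume "p \<in> cl (Z - {y})"
      then have "Z = Z - {y}" using ZY by (intro min[rule_format]) auto
      then show False using y(1) by blast
    qed
    have p_cl: "p \<in> cl (insert y (Z - {y}))" using pZ y(1) by (simp add: insert_absorb)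
    have "y \<in> V" using y(1) ZY YV by blast
    then have y_cl: "y \<in> cl (insert p (Z - {y}))" by (rule cl_exchange[OF p_cl p_ncl])
    have "y \<notin> insert p (Z - {y})" using y pY ZY by auto
    moreover have "insert p (Z - {y}) \<subseteq> V" using ZY YV elems_V by auto
    ultimately show "out y \<subseteq> cl (insert p (Z - {y}))"
      using y_cl by (rule source_cl_iff[OF y(2), THEN iffD1])
  qed
qed

lemma p_D_cases:
  assumes Y: "Y \<subseteq> elems - {d}" "indep Y" and cl: "insert p D \<subseteq> cl Y"
  obtains "Y = insert c (C \<union> D)" | "V \<subseteq> cl Y" | "Y = insert b (B \<union> D)"
    | Z where "Z \<subseteq> Y" "Z \<inter> {a1, a2, b, c, d} \<noteq> {}" "Z \<inter> {b, c, d} = {}" "a \<in> cl Y"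
        "\<And>y. y \<in> Z \<Longrightarrow> y \<in> {a1, a2} \<Longrightarrow> a \<in> cl (insert p (Z - {y}))"
proof -
  interpret BC: gadget V T out p a a1 a2 c b d C B D by (rule swap_B_C)
  have YV: "Y \<subseteq> V" using Y(1) elems_V by auto
  have "p \<in> cl Y" using cl by blast
  then obtain Z where Z: "Z \<subseteq> Y" "Z \<inter> {a1, a2, b, c, d} \<noteq> {}" "p \<in> cl Z"
    "\<And>y. y \<in> Z \<Longrightarrow> y \<in> {a1, a2, b, c, d} \<Longrightarrow> out y \<subseteq> cl (insert p (Z - {y}))"
    using ex_minimal_spanning_p[of Y] Y(1) by auto
  have out_cl: "out y \<subseteq> cl Y" if "y \<in> Z" "y \<in> {a1, a2, b, c, d}" for y
  proof -
    have "insert p (Z - {y}) \<subseteq> cl Y" using cl Z(1) subset_cl[OF YV] by blast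
    then show ?thesis using Z(4)[OF that] cl_least by blast
  qed
  consider "c \<in> Z" | "b \<in> Z" | "Z \<inter> {b, c, d} = {}" using Z(1) Y(1) by blast
  then show ?thesis
  proof cases
    case 1
    then have "insert p (C \<union> D) \<subseteq> cl Y" using out_cl[of c] out_sources cl by auto
    then show ?thesis using p_C_D_cases[OF Y] that(1,2) by blast
  next
    case 2
    then have "insert p (B \<union> D) \<subseteq> cl Y" using out_cl[of b] out_sources cl by auto
    moreover have "Y \<subseteq> BC.elems - {d}" using Y(1) by auto
    ultimately show ?thesis using BC.p_C_D_cases Y(2) that(2,3) by blast
  next
    case 3
    moreover obtain y where "y \<in> Z" "y \<in> {a1, a2}" using 3 Z(2) by blast
    then have "a \<in> cl Y" using out_cl[of y] out_sources by auto
    moreover have "a \<in> cl (insert p (Z - {y}))" if "y \<in> Z" "y \<in> {a1, a2}" for y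
      using Z(4)[of y] that out_sources by auto
    ultimately show ?thesis using that(4)[OF Z(1,2)] by blast
  qed
qed

lemma linkable_relaxed_d:
  assumes W: "W \<subseteq> V" "d \<notin> W" and Y: "d \<notin> Y"
  shows "linkable V T (out(d := insert p D \<union> W)) (insert d Y) \<longleftrightarrow>
    indep Y \<and> \<not> insert p D \<union> W \<subseteq> cl Y"
proof (rule indep_insert_source_iff)
  show "d \<in> V - T" using elems_V sources(1) by blast
  show "d \<notin> out v" if "v \<in> V" for v using sources(2)[OF that] by blast
  show "insert p D \<union> W \<subseteq> V" using W elems_V by auto
  show "d \<notin> insert p D \<union> W" using W(2) disjoint distinct_elems by auto
qed (rule Y)

lemma indep_insert_d: "d \<notin> Y \<Longrightarrow> indep (insert d Y) \<longleftrightarrow> indep Y \<and> \<not> insert p D \<subseteq> cl Y"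
  using linkable_relaxed_d[of "{}" Y] out_sources(5) fun_upd_triv[of out d] by simp

lemma linkable_relaxed_iff:
  assumes W: "W \<subseteq> V" "d \<notin> W"
    and "\<And>Y. X = insert d Y \<Longrightarrow> d \<notin> Y \<Longrightarrow> indep Y \<Longrightarrow> insert p D \<subseteq> cl Y \<Longrightarrow> W \<subseteq> cl Y"
  shows "linkable V T (out(d := insert p D \<union> W)) X \<longleftrightarrow> indep X"
proof (cases "d \<in> X")
  case True
  then obtain Y where Y: "X = insert d Y" "d \<notin> Y" by (rule mk_disjoint_insert[THEN exE]) auto
  show ?thesis
    using linkable_relaxed_d[OF W Y(2)] indep_insert_d[OF Y(2)] assms(3)[OF Y] unfolding Y(1) by auto
next
  case False
  then show ?thesis by (rule linkable_upd_iff) (use sources(2) in blast)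
qed

lemma linkable_relaxed_a_iff:
  assumes X: "X \<subseteq> elems" "X \<noteq> hyperplane" "X \<noteq> {b, d} \<union> B \<union> D"
  shows "linkable V T (out(d := insert p D \<union> {a})) X \<longleftrightarrow> indep X"
proof (rule linkable_relaxed_iff)
  show "{a} \<subseteq> V" "d \<notin> {a}" using elems_V distinct_elems by auto
  fix Y assume Y: "X = insert d Y" "d \<notin> Y" "indep Y" "insert p D \<subseteq> cl Y"
  have "Y \<subseteq> elems - {d}" using X(1) Y(1,2) by auto
  from this Y(3,4) show "{a} \<subseteq> cl Y"
  proof (cases rule: p_D_cases)
    case 1
    then show ?thesis using X(2) Y(1) by auto
  next
    case 2
    then show ?thesis using elems_V by auto
  next
    case 3
    then show ?thesis using X(3) Y(1) by auto
  qed auto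
qed

lemma linkable_relaxed_B_iff:
  assumes X: "X \<subseteq> elems" "X \<noteq> hyperplane" "a1 \<notin> X \<or> a2 \<notin> X"
  shows "linkable V T (out(d := insert p D \<union> B)) X \<longleftrightarrow> indep X"
proof (rule linkable_relaxed_iff)
  show "B \<subseteq> V" "d \<notin> B" using elems_V disjoint by auto
  fix Y assume Y: "X = insert d Y" "d \<notin> Y" "indep Y" "insert p D \<subseteq> cl Y"
  have YV: "Y \<subseteq> V" by (rule indep_subset_V[OF Y(3)])
  have YE: "Y \<subseteq> elems - {d}" using X(1) Y(1,2) by auto
  from this Y(3,4) show "B \<subseteq> cl Y"
  proof (cases rule: p_D_cases)
    case 1
    then show ?thesis using X(2) Y(1) by auto
  next
    case 2
    then show ?thesis using elems_V by auto
  next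
    case 3
    then show ?thesis using subset_cl[OF YV] by auto
  next
    case (4 Z)
    then obtain y where y: "y \<in> Z" "y \<in> {a1, a2}" by blast
    let ?Z = "insert p (Z - {y})"
    have "Z \<subseteq> X" using 4(1) Y(1) by blast
    then have "Z \<inter> {a1, a2} = {y}" using y X(3) by auto
    then have "?Z \<inter> {a1, a2, b, c, d} = {}" using 4(3) distinct_elems by auto
    with 4(5)[OF y] have "B \<union> C \<union> D \<subseteq> cl ?Z"
      using 4(1) YE YV elems_V distinct_elems disjoint by (intro generic_cl[of ?Z]) auto
    moreover have "?Z \<subseteq> cl Y" using 4(1) Y(4) subset_cl[OF YV] by blast
    ultimately show ?thesis using cl_least by blast
  qed
qed

lemma linkable_relaxed_hyperplane:
  assumes "W \<subseteq> V" "d \<notin> W" "\<not> W \<subseteq> cl (insert p (C \<union> D))"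
  shows "linkable V T (out(d := insert p D \<union> W)) hyperplane"
proof -
  have eq: "hyperplane = insert d (insert c (C \<union> D))" by auto
  have d: "d \<notin> insert c (C \<union> D)" using disjoint distinct_elems by auto
  have "insert c (C \<union> D) \<subseteq> cl (insert p (C \<union> D))" using hyperplane_subset_cl by auto
  from cl_least[OF this] have "\<not> insert p D \<union> W \<subseteq> cl (insert c (C \<union> D))"
    using assms(3) by blast
  then show ?thesis
    using linkable_relaxed_d[OF assms(1,2) d] indep_hyperplane_minus_d unfolding eq by blast
qed

lemma linkable_relaxed_a_hyperplane: "linkable V T (out(d := insert p D \<union> {a})) hyperplane"
  using elems_V distinct_elems nmem_cl_p_C_D(2) by (intro linkable_relaxed_hyperplane) auto

lemma linkable_relaxed_B_hyperplane: "linkable V T (out(d := insert p D \<union> B)) hyperplane"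
  using elems_V disjoint nmem_cl_p_C_D(1) cards(4) by (intro linkable_relaxed_hyperplane) auto

end

lemma matroid_relaxation:
  assumes "matroid M" and H: "H \<subseteq> ground M"
    and card: "\<And>X. X \<in> indep_sets M \<Longrightarrow> card X \<le> card H"
    and minus: "\<And>x. x \<in> H \<Longrightarrow> H - {x} \<in> indep_sets M"
    and exch: "\<And>x y. x \<in> H \<Longrightarrow> y \<in> ground M - H \<Longrightarrow> insert y (H - {x}) \<in> indep_sets M"
  shows "matroid \<lparr>ground = ground M, indep_sets = insert H (indep_sets M)\<rparr>"
proof -
  interpret matroid M by fact
  have finH: "finite H" using H finite_ground finite_subset by blast
  show ?thesis
  proof
    fix X Y assume X: "X \<in> indep_sets \<lparr>ground = ground M, indep_sets = insert H (indep_sets M)\<rparr>"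
      and "Y \<subseteq> X"
    show "Y \<in> indep_sets \<lparr>ground = ground M, indep_sets = insert H (indep_sets M)\<rparr>"
    proof (cases "X = H \<and> Y \<noteq> H")
      case True
      then obtain x where "x \<in> H" "Y \<subseteq> H - {x}" using \<open>Y \<subseteq> X\<close> by blast
      then show ?thesis using minus indep_subset by auto
    next
      case False
      then show ?thesis using X \<open>Y \<subseteq> X\<close> indep_subset[of X Y] by auto
    qed
  next
    fix X Y assume X: "X \<in> indep_sets \<lparr>ground = ground M, indep_sets = insert H (indep_sets M)\<rparr>"
      and Y: "Y \<in> indep_sets \<lparr>ground = ground M, indep_sets = insert H (indep_sets M)\<rparr>"
      and less: "card X < card Y"
    have "card Y \<le> card H" using Y card by auto
    then have XM: "X \<in> indep_sets M" using X less by auto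
    have "\<exists>y\<in>Y - X. y \<in> Y - X \<and> (insert y X = H \<or> insert y X \<in> indep_sets M)"
    proof (cases "Y = H")
      case False
      then show ?thesis using augment[OF XM _ less] Y by auto
    next
      case YH: True
      have finX: "finite X" using indep_subset_ground[OF XM] finite_ground finite_subset by blast
      show ?thesis
      proof (cases "X \<subseteq> H")
        case True
        moreover have "X \<noteq> H" using less YH by auto
        ultimately obtain y where y: "y \<in> H - X" by blast
        have "insert y X = H \<or> insert y X \<in> indep_sets M"
        proof (cases "insert y X = H")
          case False
          then obtain x where "x \<in> H" "insert y X \<subseteq> H - {x}" using True y by blast
          then show ?thesis using minus indep_subset by blast
        qed simp
        then show ?thesis using y YH by blast
      next
        case False
        then obtain z where z: "z \<in> X" "z \<notin> H" by blast
        have "H \<noteq> {}" using less YH by auto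
        then obtain x where x: "x \<in> H" by blast
        have "insert z (H - {x}) \<in> indep_sets M"
          using exch[OF x, of z] z indep_subset_ground[OF XM] by blast
        moreover have "card (insert z (H - {x})) = card H"
          using z(2) x finH card_Suc_Diff1[OF finH x] by simp
        ultimately obtain y where y: "y \<in> insert z (H - {x}) - X" "insert y X \<in> indep_sets M"
          using augment[OF XM, of "insert z (H - {x})"] less YH by auto
        then show ?thesis using YH z(1) by auto
      qed
    qed
    then show "\<exists>y\<in>Y - X. insert y X \<in>
        indep_sets \<lparr>ground = ground M, indep_sets = insert H (indep_sets M)\<rparr>"
      by auto
  qed (use finite_ground indep_subset_ground empty_indep H in auto)
qed

lemma contraction_singleton_cong:
  assumes "matroid M" "matroid N" "ground M = ground N" "e \<in> ground M" "{e} \<in> indep_sets M"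
    and eq: "\<And>X. e \<in> X \<Longrightarrow> X \<in> indep_sets M \<longleftrightarrow> X \<in> indep_sets N"
  shows "contraction M {e} = contraction N {e}"
proof -
  have "{e} \<in> indep_sets N" using assms(5) eq[of "{e}"] by simp
  then show ?thesis
    using assms(1-5) eq[of "insert e _"] by (simp add: contraction_singleton)
qed

context gadget
begin

definition relaxed :: "nat pre_matroid" where
  "relaxed = \<lparr>ground = elems, indep_sets = insert hyperplane {X. X \<subseteq> elems \<and> indep X}\<rparr>"

lemma relaxed_simps:
  "ground relaxed = elems"
  "X \<in> indep_sets relaxed \<longleftrightarrow> X = hyperplane \<or> X \<subseteq> elems \<and> indep X"
  unfolding relaxed_def by auto

lemma indep_hyperplane_minus:
  assumes "x \<in> hyperplane"
  shows "indep (hyperplane - {x})"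
proof -
  have "b \<notin> hyperplane" using disjoint distinct_elems by auto
  then have "hyperplane - {x} \<noteq> {b, d} \<union> B \<union> D" "hyperplane - {x} \<noteq> hyperplane"
    "hyperplane - {x} \<subseteq> elems" using assms by blast+
  then show ?thesis
    using linkable_relaxed_a_iff linkable_subset[OF linkable_relaxed_a_hyperplane Diff_subset]
    by blast
qed

lemma not_cl_hyperplane:
  assumes "X \<subseteq> hyperplane" "y \<in> elems - hyperplane"
  shows "y \<notin> cl X"
proof -
  have "X \<subseteq> cl (insert p (C \<union> D))" using assms(1) hyperplane_subset_cl by blast
  moreover have "y \<notin> cl (insert p (C \<union> D))" using assms(2) nmem_cl_p_C_D(1,3)[of y] by blast
  ultimately show ?thesis using cl_least by blast
qed

lemma indep_hyperplane_exchange: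
  assumes "x \<in> hyperplane" "y \<in> elems - hyperplane"
  shows "indep (insert y (hyperplane - {x}))"
proof -
  have "y \<notin> cl (hyperplane - {x})" by (rule not_cl_hyperplane[OF _ assms(2)]) blast
  moreover have "y \<in> V" "y \<notin> hyperplane - {x}" using assms(2) elems_subset_V by blast+
  ultimately show ?thesis using indep_insert_iff[of y "hyperplane - {x}"] indep_hyperplane_minus[OF assms(1)]
    by simp
qed

lemma matroid_relaxed: "matroid relaxed"
proof -
  have "matroid \<lparr>ground = ground (digraph_gammoid V T out elems),
      indep_sets = insert hyperplane (indep_sets (digraph_gammoid V T out elems))\<rparr>"
  proof (rule matroid_relaxation)
    show "matroid (digraph_gammoid V T out elems)"
      by (rule matroid_digraph_gammoid[OF finite_V elems_subset_V])
    show "card X \<le> card hyperplane" if "X \<in> indep_sets (digraph_gammoid V T out elems)" for X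
      using that card_indep_le_T[OF _ T_V] cards(3) card_hyperplane by (auto simp: digraph_gammoid_def)
    show "hyperplane - {x} \<in> indep_sets (digraph_gammoid V T out elems)" if "x \<in> hyperplane" for x
      using indep_hyperplane_minus[OF that] by (auto simp: digraph_gammoid_def)
    show "insert y (hyperplane - {x}) \<in> indep_sets (digraph_gammoid V T out elems)"
      if "x \<in> hyperplane" "y \<in> ground (digraph_gammoid V T out elems) - hyperplane" for x y
      using indep_hyperplane_exchange[OF that(1), of y] that(2) by (auto simp: digraph_gammoid_def)
  qed (auto simp: digraph_gammoid_def)
  then show ?thesis unfolding relaxed_def digraph_gammoid_def by simp
qed

lemma deletion_relaxed:
  assumes "\<And>X. X \<subseteq> elems - {e} \<Longrightarrow>
    linkable V T out' X \<longleftrightarrow> X = hyperplane \<or> indep X"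
  shows "deletion relaxed {e} = digraph_gammoid V T out' (elems - {e})"
  using assms unfolding deletion_def restriction_def digraph_gammoid_def relaxed_simps by auto

lemma gammoid_deletion_relaxed:
  assumes e: "e \<in> elems"
  shows "gammoid (deletion relaxed {e})"
proof -
  have "\<exists>out'. deletion relaxed {e} = digraph_gammoid V T out' (elems - {e})"
  proof (cases "e \<in> hyperplane")
    case True
    then have "deletion relaxed {e} = digraph_gammoid V T out (elems - {e})"
      by (intro deletion_relaxed) blast
    then show ?thesis by blast
  next
    case False
    then consider "e \<in> {a1, a2}" | "e \<in> insert b B" using e by blast
    then show ?thesis
    proof cases
      case 1
      have "deletion relaxed {e} = digraph_gammoid V T (out(d := insert p D \<union> B)) (elems - {e})"
      proof (rule deletion_relaxed)
        fix X assume X: "X \<subseteq> elems - {e}"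
        then have "X \<subseteq> elems" "a1 \<notin> X \<or> a2 \<notin> X" using 1 by blast+
        then show "linkable V T (out(d := insert p D \<union> B)) X \<longleftrightarrow> X = hyperplane \<or> indep X"
          using linkable_relaxed_B_iff[of X] linkable_relaxed_B_hyperplane by (cases "X = hyperplane") simp_all
      qed
      then show ?thesis by blast
    next
      case 2
      have "deletion relaxed {e} = digraph_gammoid V T (out(d := insert p D \<union> {a})) (elems - {e})"
      proof (rule deletion_relaxed)
        fix X assume X: "X \<subseteq> elems - {e}"
        then have "X \<subseteq> elems" "X \<noteq> {b, d} \<union> B \<union> D" using 2 by blast+
        then show "linkable V T (out(d := insert p D \<union> {a})) X \<longleftrightarrow> X = hyperplane \<or> indep X"
          using linkable_relaxed_a_iff[of X] linkable_relaxed_a_hyperplane by (cases "X = hyperplane") simp_all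
      qed
      then show ?thesis by blast
    qed
  qed
  moreover have "elems - {e} \<subseteq> V" using elems_subset_V by blast
  ultimately show ?thesis using gammoid_digraph_gammoid[OF finite_V T_V] by metis
qed

lemma gammoid_contraction_relaxedI:
  assumes e: "e \<in> elems"
    and eq: "\<And>X. e \<in> X \<Longrightarrow> X \<subseteq> elems \<Longrightarrow> linkable V T out' X \<longleftrightarrow> X = hyperplane \<or> indep X"
  shows "gammoid (contraction relaxed {e})"
proof -
  have "{e} \<in> indep_sets relaxed"
  proof (cases "e \<in> hyperplane")
    case True
    have "hyperplane \<in> indep_sets relaxed" unfolding relaxed_simps by blast
    then show ?thesis using matroid.indep_subset[OF matroid_relaxed] True by blast
  next
    case False
    have "insert e (hyperplane - {c}) \<in> indep_sets relaxed"
      using indep_hyperplane_exchange[of c e] e False unfolding relaxed_simps by blast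
    then show ?thesis using matroid.indep_subset[OF matroid_relaxed] by blast
  qed
  moreover have "X \<in> indep_sets relaxed \<longleftrightarrow> X \<in> indep_sets (digraph_gammoid V T out' elems)"
    if "e \<in> X" for X
    using eq[OF that] unfolding relaxed_simps digraph_gammoid_def by auto
  ultimately have "contraction relaxed {e} = contraction (digraph_gammoid V T out' elems) {e}"
    using e relaxed_simps(1)
    by (intro contraction_singleton_cong matroid_relaxed
        matroid_digraph_gammoid[OF finite_V elems_subset_V]) (simp_all add: digraph_gammoid_def)
  then show ?thesis
    using gammoid_contraction_digraph_gammoid[OF finite_V T_V elems_subset_V e] by simp
qed

lemma gammoid_contraction_relaxed_c:
  assumes "e \<in> insert c C"
  shows "gammoid (contraction relaxed {e})"
proof (rule gammoid_contraction_relaxedI)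
  show "e \<in> elems" using assms by blast
  fix X assume X: "e \<in> X" "X \<subseteq> elems"
  have "e \<notin> {b, d} \<union> B \<union> D" using assms disjoint distinct_elems by auto
  then have "X \<noteq> {b, d} \<union> B \<union> D" using X(1) by blast
  then show "linkable V T (out(d := insert p D \<union> {a})) X \<longleftrightarrow> X = hyperplane \<or> indep X"
    using linkable_relaxed_a_iff[OF X(2)] linkable_relaxed_a_hyperplane
    by (cases "X = hyperplane") simp_all
qed

lemma gammoid_contraction_relaxed:
  assumes e: "e \<in> elems"
  shows "gammoid (contraction relaxed {e})"
proof -
  interpret CD: gadget V T out p a a1 a2 b d c B D C by (rule swap_C_D)
  have swap: "CD.relaxed = relaxed"
  proof -
    have "CD.elems = elems" "CD.hyperplane = hyperplane" by auto
    then show ?thesis unfolding CD.relaxed_def relaxed_def by simp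
  qed
  consider "e \<in> insert c C" | "e \<in> insert d D" | "e \<notin> hyperplane" by blast
  then show ?thesis
  proof cases
    case 1
    then show ?thesis by (rule gammoid_contraction_relaxed_c)
  next
    case 2
    then show ?thesis using CD.gammoid_contraction_relaxed_c swap by simp
  next
    case 3
    then show ?thesis using e by (intro gammoid_contraction_relaxedI[where out' = out]) blast+
  qed
qed

lemma dependent_a1_a2_c_C: "\<not> indep ({a1, a2, c} \<union> C)"
proof
  assume ind: "indep ({a1, a2, c} \<union> C)"
  let ?X = "insert p (insert a C)"
  have X: "?X \<subseteq> V" using elems_V by auto
  have nin: "a1 \<notin> ?X" "a2 \<notin> ?X" "c \<notin> ?X" using disjoint distinct_elems by auto
  have sub: "?X \<subseteq> cl ?X" by (rule subset_cl[OF X])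
  have "a1 \<in> cl ?X" "a2 \<in> cl ?X" "c \<in> cl ?X"
    using source_cl_iff[OF _ nin(1) X] source_cl_iff[OF _ nin(2) X] source_cl_iff[OF _ nin(3) X]
      out_sources sub by auto
  then have "card ({a1, a2, c} \<union> C) \<le> card ?X"
    using sub by (intro card_indep_le[OF ind _ X]) auto
  moreover have "card ({a1, a2, c} \<union> C) = card C + 3" "card ?X = card C + 2"
    using disjoint distinct_elems finite_parts by auto
  ultimately show False by simp
qed

lemma indep_a1_c_C_D: "indep (insert a1 (insert c (C \<union> D)))"
proof -
  have "a1 \<notin> insert c (C \<union> D)" "a1 \<in> elems - hyperplane" using disjoint distinct_elems by auto
  moreover have "a1 \<notin> cl (insert c (C \<union> D))"
    by (rule not_cl_hyperplane) (use calculation in blast)+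
  moreover have "a1 \<in> V" using elems_subset_V by blast
  ultimately show ?thesis
    using indep_insert_iff[of a1 "insert c (C \<union> D)"] indep_hyperplane_minus_d by simp
qed

lemma indep_a1_a2: "indep {a2, a1}"
proof -
  have a1: "indep {a1}" by (rule linkable_subset[OF indep_a1_c_C_D]) blast
  have V: "{a1} \<subseteq> V" "a2 \<in> V" using elems_subset_V by blast+
  have "a2 \<notin> cl {a1}"
  proof
    assume "a2 \<in> cl {a1}"
    then have pa: "{p, a} \<subseteq> cl {a1}"
      using source_cl_iff[OF _ _ V(1), of a2] distinct_elems out_sources by auto
    have "a \<notin> cl {}" using generic_cl[of "{}"] nmem_cl_p_C_D(2) cl_mono[of "{}" "insert p (C \<union> D)"] by blast
    moreover have "a \<in> V" "p \<in> V" using elems_V by auto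
    ultimately have "indep {a}" using indep_insert_iff[of a "{}"] indep_empty by simp
    then have "indep {p, a}" using distinct_elems by (intro coloop) auto
    then have "card {p, a} \<le> card {a1}" using pa V(1) by (rule card_indep_le)
    then show False using distinct_elems by auto
  qed
  then show ?thesis using indep_insert_iff[OF V(2), of "{a1}"] a1 distinct_elems by auto
qed

lemma not_gammoid_relaxed: "\<not> gammoid relaxed"
proof
  assume "gammoid relaxed"
  then obtain V' T' out' S where V': "finite V'" "S \<subseteq> V'"
    and iso: "matroid_iso relaxed (digraph_gammoid V' T' out' S)" by (rule gammoidE)
  interpret L: linkage V' T' out' using V'(1) by unfold_locales
  interpret BC: gadget V T out p a a1 a2 c b d C B D by (rule swap_B_C)
  interpret CD: gadget V T out p a a1 a2 b d c B D C by (rule swap_C_D)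
  interpret CDB: gadget V T out p a a1 a2 d b c D B C by (rule CD.swap_B_C)
  obtain f where f: "bij_betw f elems S"
    and f_iff: "\<forall>X. X \<subseteq> elems \<longrightarrow>
      (X \<in> indep_sets relaxed \<longleftrightarrow> f ` X \<in> indep_sets (digraph_gammoid V' T' out' S))"
    using iso unfolding matroid_iso_def relaxed_simps(1) by (auto simp: digraph_gammoid_def)
  have inj: "inj_on f elems" and fS: "f ` elems = S" using f unfolding bij_betw_def by auto
  have fV: "f ` X \<subseteq> V'" if "X \<subseteq> elems" for X using that fS V'(2) by blast
  have iff: "L.indep (f ` X) \<longleftrightarrow> X = hyperplane \<or> indep X" if "X \<subseteq> elems" for X
    using f_iff[rule_format, OF that] that fS unfolding relaxed_simps digraph_gammoid_def by auto
  have f_mem: "f x \<in> f ` X \<longleftrightarrow> x \<in> X" if "x \<in> elems" "X \<subseteq> elems" for x X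
    using inj_on_image_mem_iff[OF inj that] .
  have ncl: "f x \<notin> L.cl (f ` X)" if "insert x X \<subseteq> elems" "x \<notin> X" "indep (insert x X)" for x X
    using L.indep_insert_not_cl[of "f x" "f ` X"] iff[of "insert x X"] f_mem[of x X] that by auto
  have in_cl: "f x \<in> L.cl (f ` X)"
    if "insert x X \<subseteq> elems" "insert x X \<noteq> hyperplane" "indep X" "\<not> indep (insert x X)" for x X
    using L.cl_iff_indep[of "f ` X" "f x"] iff[of X] iff[of "insert x X"] fV[of "insert x X"] that
    by auto
  have a1_ncl: "f a1 \<notin> L.cl (f ` (insert b B) \<union> f ` (insert z Z))"
    if Z: "insert z Z \<subseteq> elems" "{b, z} \<union> B \<union> Z \<noteq> hyperplane" "a1 \<notin> insert b B \<union> Z"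
      "indep (insert a1 (insert b (B \<union> Z)))" "\<not> indep ({b, z} \<union> B \<union> Z)" for z Z
  proof -
    let ?W = "insert b (B \<union> Z)"
    have W: "indep ?W" by (rule linkable_subset[OF Z(4)]) blast
    have eq: "insert z ?W = {b, z} \<union> B \<union> Z" by auto
    have "f z \<in> L.cl (f ` ?W)"
      using Z(1,2,5) W eq by (intro in_cl) auto
    moreover have "f ` ?W \<subseteq> L.cl (f ` ?W)"
      using Z(1) by (intro L.subset_cl fV) auto
    ultimately have "f ` (insert b B) \<union> f ` (insert z Z) \<subseteq> L.cl (f ` ?W)" by auto
    then have "L.cl (f ` (insert b B) \<union> f ` (insert z Z)) \<subseteq> L.cl (f ` ?W)" by (rule L.cl_least)
    moreover have "f a1 \<notin> L.cl (f ` ?W)" using Z by (intro ncl) auto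
    ultimately show ?thesis by blast
  qed
  have a2_in_cl: "f a2 \<in> L.cl (insert (f a1) (f ` (insert z Z)))"
    if Z: "insert z Z \<subseteq> elems" "indep (insert a1 (insert z Z))" "\<not> indep ({a1, a2, z} \<union> Z)" for z Z
  proof -
    have eq: "{a1, a2, z} \<union> Z = insert a2 (insert a1 (insert z Z))" by auto
    have "a1 \<notin> hyperplane" using disjoint distinct_elems by auto
    then have "f a2 \<in> L.cl (f ` (insert a1 (insert z Z)))"
      using Z eq by (intro in_cl) auto
    then show ?thesis by simp
  qed
  have not_H: "a1 \<notin> hyperplane" "b \<notin> hyperplane" using disjoint distinct_elems by auto
  have "\<not> L.indep (f ` (insert c C) \<union> f ` (insert d D))"
  proof (rule L.common_point_dependent[of "f a1" "f a2" "f ` (insert b B)"])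
    show "f a1 \<in> V'" "f a2 \<in> V'" using fV[of "{a1, a2}"] by auto
    show "f ` (insert b B) \<subseteq> V'" "f ` (insert c C) \<subseteq> V'" "f ` (insert d D) \<subseteq> V'"
      by (rule fV, blast)+
    have "f a2 \<notin> L.cl (f ` {a1})" using indep_a1_a2 distinct_elems by (intro ncl) auto
    then show "f a2 \<notin> L.cl {f a1}" by simp
    show "f a2 \<in> L.cl (insert (f a1) (f ` (insert b B)))"
    proof (rule a2_in_cl)
      show "indep (insert a1 (insert b B))"
        by (rule linkable_subset[OF BC.indep_a1_c_C_D]) blast
    qed (use BC.dependent_a1_a2_c_C in auto)
    show "f a2 \<in> L.cl (insert (f a1) (f ` (insert c C)))"
    proof (rule a2_in_cl)
      show "indep (insert a1 (insert c C))"
        by (rule linkable_subset[OF indep_a1_c_C_D]) blast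
    qed (use dependent_a1_a2_c_C in auto)
    show "f a2 \<in> L.cl (insert (f a1) (f ` (insert d D)))"
    proof (rule a2_in_cl)
      show "indep (insert a1 (insert d D))"
        by (rule linkable_subset[OF CD.indep_a1_c_C_D]) blast
    qed (use CD.dependent_a1_a2_c_C in auto)
    show "f a1 \<notin> L.cl (f ` (insert b B) \<union> f ` (insert c C))"
    proof (rule a1_ncl)
      show "{b, c} \<union> B \<union> C \<noteq> hyperplane" using not_H by blast
      show "a1 \<notin> insert b B \<union> C" using disjoint distinct_elems by auto
    qed (use CDB.indep_a1_c_C_D CDB.hyperplane_dependent in auto)
    show "f a1 \<notin> L.cl (f ` (insert b B) \<union> f ` (insert d D))"
    proof (rule a1_ncl)
      show "{b, d} \<union> B \<union> D \<noteq> hyperplane" using not_H by blast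
      show "a1 \<notin> insert b B \<union> D" using disjoint distinct_elems by auto
    qed (use BC.indep_a1_c_C_D BC.hyperplane_dependent in auto)
    have "insert c C \<inter> insert d D = {}" using disjoint distinct_elems by auto
    moreover have "f ` (insert c C \<inter> insert d D) = f ` (insert c C) \<inter> f ` (insert d D)"
      by (rule inj_on_image_Int[OF inj]) auto
    ultimately show "f ` (insert c C) \<inter> f ` (insert d D) = {}" by simp
  qed
  moreover have "f ` (insert c C) \<union> f ` (insert d D) = f ` hyperplane" by auto
  ultimately show False using iff[of hyperplane] by auto
qed

lemma excluded_minor_relaxed: "excluded_minor gammoid relaxed"
  unfolding excluded_minor_def relaxed_simps
  using matroid_relaxed not_gammoid_relaxed gammoid_deletion_relaxed gammoid_contraction_relaxed
  by blast

end

section \<open>Embedding a gammoid\<close>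

lemma matroid_iso_sym:
  assumes "matroid_iso M N"
  shows "matroid_iso N M"
proof -
  obtain f where f: "bij_betw f (ground M) (ground N)"
    and iff: "\<forall>X. X \<subseteq> ground M \<longrightarrow> (X \<in> indep_sets M \<longleftrightarrow> f ` X \<in> indep_sets N)"
    using assms unfolding matroid_iso_def by blast
  let ?g = "inv_into (ground M) f"
  have g: "bij_betw ?g (ground N) (ground M)" using f by (rule bij_betw_inv_into)
  have "X \<in> indep_sets N \<longleftrightarrow> ?g ` X \<in> indep_sets M" if "X \<subseteq> ground N" for X
  proof -
    have "?g ` X \<subseteq> ground M" using g that unfolding bij_betw_def by blast
    moreover have "f ` (?g ` X) = X" using f that unfolding bij_betw_def by (simp add: image_inv_into_cancel)
    ultimately show ?thesis using iff by metis
  qed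
  then show ?thesis unfolding matroid_iso_def using g by blast
qed

lemma matroid_iso_trans:
  assumes "matroid_iso L M" "matroid_iso M N"
  shows "matroid_iso L N"
proof -
  obtain f where f: "bij_betw f (ground L) (ground M)"
    and f_iff: "\<forall>X. X \<subseteq> ground L \<longrightarrow> (X \<in> indep_sets L \<longleftrightarrow> f ` X \<in> indep_sets M)"
    using assms(1) unfolding matroid_iso_def by blast
  obtain g where g: "bij_betw g (ground M) (ground N)"
    and g_iff: "\<forall>X. X \<subseteq> ground M \<longrightarrow> (X \<in> indep_sets M \<longleftrightarrow> g ` X \<in> indep_sets N)"
    using assms(2) unfolding matroid_iso_def by blast
  have "X \<in> indep_sets L \<longleftrightarrow> (g \<circ> f) ` X \<in> indep_sets N" if "X \<subseteq> ground L" for X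
  proof -
    have "f ` X \<subseteq> ground M" using f that unfolding bij_betw_def by blast
    then show ?thesis using f_iff[rule_format, OF that] g_iff by (simp add: image_comp)
  qed
  then show ?thesis unfolding matroid_iso_def using bij_betw_trans[OF f g] by blast
qed

lemma linkable_image:
  assumes inj: "inj f" and out: "\<And>v. v \<in> V \<Longrightarrow> out' (f v) = f ` out v"
  shows "linkable (f ` V) (f ` T) out' (f ` X) \<longleftrightarrow> linkable V T out X"
proof
  assume "linkable V T out X"
  then obtain g where X: "X \<subseteq> V" and g: "inj_on g (V - T)"
    "\<forall>v\<in>V - T. g v \<in> V - X \<and> (g v = v \<or> g v \<in> out v)"
    unfolding linkable_def by (elim conjE exE)
  show "linkable (f ` V) (f ` T) out' (f ` X)"
  proof (rule linkableI[where g = "f \<circ> g \<circ> inv f"])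
    show "f ` X \<subseteq> f ` V" using X by blast
    have dom: "f ` V - f ` T = f ` (V - T)" using inj by (simp add: image_set_diff)
    show "inj_on (f \<circ> g \<circ> inv f) (f ` V - f ` T)"
      unfolding dom using g(1) inj by (auto simp: inj_on_def)
    fix w assume "w \<in> f ` V - f ` T"
    then obtain v where v: "v \<in> V - T" "w = f v" unfolding dom by blast
    then show "(f \<circ> g \<circ> inv f) w \<in> f ` V - f ` X \<and>
        ((f \<circ> g \<circ> inv f) w = w \<or> (f \<circ> g \<circ> inv f) w \<in> out' w)"
      using g(2)[rule_format, OF v(1)] out[of v] inj by (auto simp: inj_image_mem_iff)
  qed
next
  assume "linkable (f ` V) (f ` T) out' (f ` X)"
  then obtain g where X: "f ` X \<subseteq> f ` V" and g: "inj_on g (f ` V - f ` T)"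
    "\<forall>v\<in>f ` V - f ` T. g v \<in> f ` V - f ` X \<and> (g v = v \<or> g v \<in> out' v)"
    unfolding linkable_def by (elim conjE exE)
  have dom: "f v \<in> f ` V - f ` T" if "v \<in> V - T" for v
    using that inj by (auto simp: inj_image_mem_iff)
  have ex: "\<exists>u\<in>V. g (f v) = f u \<and> u \<notin> X \<and> (u = v \<or> u \<in> out v)" if v: "v \<in> V - T" for v
  proof -
    have gv: "g (f v) \<in> f ` V - f ` X" "g (f v) = f v \<or> g (f v) \<in> f ` out v"
      using g(2)[rule_format, OF dom[OF v]] out[of v] v by auto
    then obtain u where u: "u \<in> V" "g (f v) = f u" by blast
    then show ?thesis using gv inj by (auto simp: inj_image_mem_iff inj_eq)
  qed
  then obtain h where h: "\<forall>v\<in>V - T. h v \<in> V \<and> g (f v) = f (h v) \<and> h v \<notin> X \<and> (h v = v \<or> h v \<in> out v)"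
    by metis
  show "linkable V T out X"
  proof (rule linkableI[where g = h])
    show "X \<subseteq> V" using X inj by (simp add: inj_image_subset_iff)
    show "inj_on h (V - T)"
    proof (rule inj_onI)
      fix u v assume uv: "u \<in> V - T" "v \<in> V - T" "h u = h v"
      then have "g (f u) = g (f v)" using h by auto
      then have "f u = f v" using inj_onD[OF g(1)] dom uv by blast
      then show "u = v" using inj by (simp add: inj_eq)
    qed
  qed (use h in blast)
qed

datatype vertex =
  vp | vq | va | va1 | va2 | vb | vc | vd
| VB "nat option" | VC "nat option" | VD "nat option"

instance vertex :: countable
  by countable_datatype

context
  fixes V0 T0 :: "nat set" and out0 :: "nat \<Rightarrow> nat set"
  assumes V0: "finite V0" "T0 \<subseteq> V0"
begin

abbreviation ixs :: "nat option set" where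
  "ixs \<equiv> insert None (Some ` V0)"

abbreviation srcs :: "vertex set" where
  "srcs \<equiv> {va1, va2, vb, vc, vd}"

definition verts_of :: "vertex set" where
  "verts_of = {vp, vq, va} \<union> srcs \<union> VB ` ixs \<union> VC ` ixs \<union> VD ` ixs"

definition targets_of :: "vertex set" where
  "targets_of = {vp, vq} \<union> VB ` ixs \<union> VC ` ixs"

fun out_of :: "vertex \<Rightarrow> vertex set" where
  "out_of (VD i) = {VC i, vq, VB i} \<union> (case i of None \<Rightarrow> {} | Some v \<Rightarrow> VB ` Some ` (out0 v \<inter> V0))"
| "out_of va = {vq} \<union> VB ` ixs \<union> VC ` ixs \<union> VD ` ixs"
| "out_of va1 = {vp, va}"
| "out_of va2 = {vp, va}"
| "out_of vb = insert vp (VB ` ixs)"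
| "out_of vc = insert vp (VC ` ixs)"
| "out_of vd = insert vp (VD ` ixs)"
| "out_of _ = {}"

abbreviation lnk :: "vertex set \<Rightarrow> bool" where
  "lnk \<equiv> linkable verts_of targets_of out_of"

lemma movers: "verts_of - targets_of = insert va srcs \<union> VD ` ixs"
  unfolding verts_of_def targets_of_def by auto

lemma out_of_srcs: "out_of v \<inter> srcs = {}"
  by (cases v) (auto split: option.splits)

lemma out_of_VD_va: "v \<in> insert va (VD ` ixs) \<Longrightarrow> vp \<notin> out_of v \<and> va \<notin> out_of v"
  by (auto split: option.splits)

lemma lnk_insert_vp:
  assumes "lnk X" "X \<inter> srcs = {}"
  shows "lnk (insert vp X)"
proof -
  obtain g where X: "X \<subseteq> verts_of" and g: "inj_on g (verts_of - targets_of)"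
    "\<forall>v\<in>verts_of - targets_of. g v \<in> verts_of - X \<and> (g v = v \<or> g v \<in> out_of v)"
    using assms(1) unfolding linkable_def by (elim conjE exE)
  let ?h = "\<lambda>v. if v \<in> srcs then v else g v"
  have h: "g v \<in> verts_of - insert vp X \<and> g v \<notin> srcs \<and> (g v = v \<or> g v \<in> out_of v)"
    if v: "v \<in> verts_of - targets_of" "v \<notin> srcs" for v
  proof -
    have "v \<in> insert va (VD ` ixs)" using v unfolding movers by blast
    then have "vp \<notin> out_of v" "v \<noteq> vp" using out_of_VD_va by blast+
    then show ?thesis using g(2)[rule_format, OF v(1)] v(2) out_of_srcs[of v] by auto
  qed
  show ?thesis
  proof (rule linkableI[where g = ?h])
    show "insert vp X \<subseteq> verts_of" using X unfolding verts_of_def by blast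
    show "inj_on ?h (verts_of - targets_of)"
      using g(1) h unfolding inj_on_def by metis
    show "?h v \<in> verts_of - insert vp X \<and> (?h v = v \<or> ?h v \<in> out_of v)"
      if "v \<in> verts_of - targets_of" for v
      using h[OF that] that assms(2) by auto
  qed
qed

lemma lnk_insert_va:
  assumes k: "k \<in> VB ` ixs \<union> VC ` ixs \<union> VD ` ixs" "k \<notin> X" and X0: "X \<inter> srcs = {}"
    and "lnk (insert k X)"
  shows "lnk (insert va X)"
proof -
  obtain g where X: "insert k X \<subseteq> verts_of" and g: "inj_on g (verts_of - targets_of)"
    "\<forall>v\<in>verts_of - targets_of. g v \<in> verts_of - insert k X \<and> (g v = v \<or> g v \<in> out_of v)"
    using assms(4) unfolding linkable_def by (elim conjE exE)
  let ?h = "\<lambda>v. if v \<in> srcs then v else if v = va then k else g v"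
  have h: "g v \<in> verts_of - insert va X \<and> g v \<notin> srcs \<and> g v \<noteq> k \<and> (g v = v \<or> g v \<in> out_of v)"
    if v: "v \<in> verts_of - targets_of" "v \<notin> srcs" "v \<noteq> va" for v
  proof -
    have "v \<in> insert va (VD ` ixs)" using v unfolding movers by blast
    then have "va \<notin> out_of v" using out_of_VD_va by blast
    then show ?thesis using g(2)[rule_format, OF v(1)] v(2,3) out_of_srcs[of v] by auto
  qed
  have kne: "k \<notin> srcs" "k \<noteq> va" using k(1) by auto
  show ?thesis
  proof (rule linkableI[where g = ?h])
    show "insert va X \<subseteq> verts_of" using X unfolding verts_of_def by blast
    show "inj_on ?h (verts_of - targets_of)"
    proof (rule inj_onI)
      fix u v assume uv: "u \<in> verts_of - targets_of" "v \<in> verts_of - targets_of" "?h u = ?h v"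
      show "u = v"
        using uv h[OF uv(1)] h[OF uv(2)] kne inj_onD[OF g(1) _ uv(1,2)]
        by (cases "u \<in> srcs"; cases "v \<in> srcs"; cases "u = va"; cases "v = va"; simp; metis)
    qed
    fix v assume v: "v \<in> verts_of - targets_of"
    consider "v \<in> srcs" | "v = va" | "v \<notin> srcs" "v \<noteq> va" by blast
    then show "?h v \<in> verts_of - insert va X \<and> (?h v = v \<or> ?h v \<in> out_of v)"
    proof cases
      case 1
      then show ?thesis using v X0 by auto
    next
      case 2
      then show ?thesis using k X kne by auto
    next
      case 3
      then show ?thesis using h[OF v] by auto
    qed
  qed
qed

lemma lnk_by_VD:
  assumes "X \<subseteq> verts_of" "X \<inter> insert va srcs = {}" "inj_on h ixs"
    "\<And>i. i \<in> ixs \<Longrightarrow> h i \<in> verts_of - X \<and> h i \<notin> insert va srcs \<and> (h i = VD i \<or> h i \<in> out_of (VD i))"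
  shows "lnk X"
proof -
  let ?g = "\<lambda>v. case v of VD i \<Rightarrow> h i | _ \<Rightarrow> v"
  have src: "?g v = v" if "v \<in> insert va srcs" for v using that by auto
  show ?thesis
  proof (rule linkableI[where g = ?g, OF assms(1)])
    show "inj_on ?g (verts_of - targets_of)"
    proof (rule inj_onI)
      fix u v assume u: "u \<in> verts_of - targets_of" and v: "v \<in> verts_of - targets_of"
        and eq: "?g u = ?g v"
      have *: "x \<in> insert va srcs \<and> ?g x = x \<or> (\<exists>i\<in>ixs. x = VD i \<and> ?g x = h i \<and> h i \<notin> insert va srcs)"
        if "x \<in> verts_of - targets_of" for x
        using that src[of x] assms(4) unfolding movers by fastforce
      show "u = v" using *[OF u] *[OF v] eq inj_onD[OF assms(3)] by metis
    qed
    fix v assume v: "v \<in> verts_of - targets_of"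
    then consider "v \<in> insert va srcs" | i where "i \<in> ixs" "v = VD i" unfolding movers by blast
    then show "?g v \<in> verts_of - X \<and> (?g v = v \<or> ?g v \<in> out_of v)"
    proof cases
      case 1
      then show ?thesis using v src[OF 1] assms(2) by auto
    next
      case (2 i)
      then show ?thesis using assms(4)[OF 2(1)] by simp
    qed
  qed
qed

lemma lnk_bases:
  assumes "i \<in> ixs"
  shows "lnk (insert vp (insert (VD i) (VB ` ixs \<union> VC ` ixs)))"
    and "lnk (insert vp (insert (VC i) (VB ` ixs \<union> VD ` ixs)))"
    and "lnk (insert vp (insert (VB i) (VC ` ixs \<union> VD ` ixs)))"
proof -
  show "lnk (insert vp (insert (VD i) (VB ` ixs \<union> VC ` ixs)))"
    by (rule lnk_by_VD[where h = "\<lambda>j. if j = i then vq else VD j"])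
      (use assms in \<open>auto simp: verts_of_def inj_on_def split: if_splits\<close>)
  show "lnk (insert vp (insert (VC i) (VB ` ixs \<union> VD ` ixs)))"
    by (rule lnk_by_VD[where h = "\<lambda>j. if j = i then vq else VC j"])
      (use assms in \<open>auto simp: verts_of_def inj_on_def split: if_splits\<close>)
  show "lnk (insert vp (insert (VB i) (VC ` ixs \<union> VD ` ixs)))"
    by (rule lnk_by_VD[where h = "\<lambda>j. if j = i then vq else VB j"])
      (use assms in \<open>auto simp: verts_of_def inj_on_def split: if_splits\<close>)
qed

definition contracted_set :: "vertex set" where
  "contracted_set = VC ` ixs \<union> {VB None, VD None} \<union> VD ` Some ` (V0 - T0)"

text \<open>
  In \<^term>\<open>contracted_set\<close>, \<open>VB None\<close> forces \<open>VD None\<close> to move to \<open>vq\<close>, so the remaining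
  \<open>VD (Some v)\<close> have to move to some \<open>VB (Some w)\<close> with \<open>w = v\<close> or \<open>w\<close> an out-neighbour of \<open>v\<close>.
\<close>

lemma lnk_contracted_iff:
  assumes X0: "X0 \<subseteq> V0"
  shows "lnk (VB ` Some ` X0 \<union> contracted_set) \<longleftrightarrow> linkable V0 T0 out0 X0"
proof
  assume "lnk (VB ` Some ` X0 \<union> contracted_set)"
  then obtain g where g: "inj_on g (verts_of - targets_of)"
    "\<forall>v\<in>verts_of - targets_of. g v \<in> verts_of - (VB ` Some ` X0 \<union> contracted_set) \<and>
      (g v = v \<or> g v \<in> out_of v)"
    unfolding linkable_def by (elim conjE exE)
  have mov: "VD i \<in> verts_of - targets_of" if "i \<in> ixs" for i using that unfolding movers by blast
  have None: "g (VD None) = vq"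
    using g(2)[rule_format, OF mov[of None]] unfolding contracted_set_def by auto
  have "\<exists>w. g (VD (Some v)) = VB (Some w) \<and> w \<in> V0 - X0 \<and> (w = v \<or> w \<in> out0 v)"
    if v: "v \<in> V0 - T0" for v
  proof -
    have m: "VD (Some v) \<in> verts_of - targets_of" using v by (intro mov) auto
    have "g (VD (Some v)) \<noteq> vq"
      using inj_onD[OF g(1) _ m mov[of None]] None by auto
    then show ?thesis
      using g(2)[rule_format, OF m] v unfolding contracted_set_def by auto
  qed
  then obtain h where h: "\<And>v. v \<in> V0 - T0 \<Longrightarrow> g (VD (Some v)) = VB (Some (h v)) \<and>
      h v \<in> V0 - X0 \<and> (h v = v \<or> h v \<in> out0 v)"
    by metis
  show "linkable V0 T0 out0 X0"
  proof (rule linkableI[where g = h, OF X0])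
    show "inj_on h (V0 - T0)"
    proof (rule inj_onI)
      fix u v assume uv: "u \<in> V0 - T0" "v \<in> V0 - T0" "h u = h v"
      then have "g (VD (Some u)) = g (VD (Some v))" using h by simp
      moreover have "VD (Some u) \<in> verts_of - targets_of" "VD (Some v) \<in> verts_of - targets_of"
        using uv(1,2) mov by auto
      ultimately have "VD (Some u) = VD (Some v)" by (rule inj_onD[OF g(1)])
      then show "u = v" by simp
    qed
  qed (use h in blast)
next
  assume "linkable V0 T0 out0 X0"
  then obtain k where k: "inj_on k (V0 - T0)"
    "\<forall>v\<in>V0 - T0. k v \<in> V0 - X0 \<and> (k v = v \<or> k v \<in> out0 v)"
    unfolding linkable_def by (elim conjE exE)
  let ?h = "\<lambda>i. case i of None \<Rightarrow> vq | Some v \<Rightarrow> if v \<in> T0 then VD (Some v) else VB (Some (k v))"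
  show "lnk (VB ` Some ` X0 \<union> contracted_set)"
  proof (rule lnk_by_VD[where h = ?h])
    show "VB ` Some ` X0 \<union> contracted_set \<subseteq> verts_of"
      using X0 unfolding contracted_set_def verts_of_def by auto
    show "(VB ` Some ` X0 \<union> contracted_set) \<inter> insert va srcs = {}"
      unfolding contracted_set_def by auto
    show "inj_on ?h ixs"
      using k(1) by (auto simp: inj_on_def split: option.splits if_splits)
    fix i assume i: "i \<in> ixs"
    show "?h i \<in> verts_of - (VB ` Some ` X0 \<union> contracted_set) \<and> ?h i \<notin> insert va srcs \<and>
        (?h i = VD i \<or> ?h i \<in> out_of (VD i))"
    proof (cases i)
      case None
      then show ?thesis unfolding contracted_set_def verts_of_def by auto
    next
      case (Some v)
      then show ?thesis
        using i k(2)[rule_format, of v] V0(2) unfolding contracted_set_def verts_of_def by auto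
    qed
  qed
qed

definition code_out :: "nat \<Rightarrow> nat set" where
  "code_out n = to_nat ` out_of (from_nat n)"

abbreviation code_linkable :: "nat set \<Rightarrow> bool" where
  "code_linkable \<equiv> linkable (to_nat ` verts_of) (to_nat ` targets_of) code_out"

lemma code_linkable_image: "code_linkable (to_nat ` X) \<longleftrightarrow> lnk X"
  by (rule linkable_image) (simp_all add: code_out_def)

lemma code_linkableE:
  assumes "code_linkable Y"
  obtains X where "Y = to_nat ` X" "lnk X"
proof -
  have "Y \<subseteq> to_nat ` verts_of" using assms unfolding linkable_def by blast
  then obtain X :: "vertex set" where "Y = to_nat ` X" by (auto simp: subset_image_iff)
  then show ?thesis using that assms code_linkable_image by simp
qed

lemma gadget_code:
  "gadget (to_nat ` verts_of) (to_nat ` targets_of) code_out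
     (to_nat vp) (to_nat va) (to_nat va1) (to_nat va2) (to_nat vb) (to_nat vc) (to_nat vd)
     (to_nat ` VB ` ixs) (to_nat ` VC ` ixs) (to_nat ` VD ` ixs)"
proof unfold_locales
  let ?f = "to_nat :: vertex \<Rightarrow> nat"
  let ?S = "{?f va1, ?f va2, ?f vb, ?f vc, ?f vd}"
  have S: "?S = ?f ` srcs" by auto
  have inter: "?f ` X \<inter> ?S = {} \<longleftrightarrow> X \<inter> srcs = {}" for X
    unfolding S by (simp only: image_Int[OF inj_to_nat, symmetric] image_is_empty)
  note card_to_nat = card_image[OF inj_on_subset[OF inj_to_nat subset_UNIV]]
  have cardI: "card (?f ` F ` ixs) = card ixs" if "inj F" for F
    by (simp only: card_to_nat card_image[OF inj_on_subset[OF that subset_UNIV]])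
  have inj: "inj VB" "inj VC" "inj VD" by (auto simp: inj_def)
  show "finite (?f ` verts_of)" using V0(1) unfolding verts_of_def by simp
  show "?f ` targets_of \<subseteq> ?f ` verts_of" unfolding targets_of_def verts_of_def by auto
  show "{?f vp, ?f va, ?f va1, ?f va2, ?f vb, ?f vc, ?f vd} \<union> ?f ` VB ` ixs \<union> ?f ` VC ` ixs \<union>
      ?f ` VD ` ixs \<subseteq> ?f ` verts_of" unfolding verts_of_def by auto
  show "distinct [?f vp, ?f va, ?f va1, ?f va2, ?f vb, ?f vc, ?f vd]" by simp
  show "{?f vp, ?f va, ?f va1, ?f va2, ?f vb, ?f vc, ?f vd} \<inter>
      (?f ` VB ` ixs \<union> ?f ` VC ` ixs \<union> ?f ` VD ` ixs) = {}"
    "?f ` VB ` ixs \<inter> ?f ` VC ` ixs = {}" "?f ` VB ` ixs \<inter> ?f ` VD ` ixs = {}"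
    "?f ` VC ` ixs \<inter> ?f ` VD ` ixs = {}"
    by auto
  show "?S \<inter> ?f ` targets_of = {}" unfolding targets_of_def by auto
  show "code_out v \<inter> ?S = {}" if "v \<in> ?f ` verts_of" for v
    unfolding code_out_def inter by (rule out_of_srcs)
  show "code_out (?f va1) = {?f vp, ?f va}" "code_out (?f va2) = {?f vp, ?f va}"
    "code_out (?f vb) = insert (?f vp) (?f ` VB ` ixs)"
    "code_out (?f vc) = insert (?f vp) (?f ` VC ` ixs)"
    "code_out (?f vd) = insert (?f vp) (?f ` VD ` ixs)"
    by (simp_all add: code_out_def)
  show "card (?f ` VC ` ixs) = card (?f ` VB ` ixs)" "card (?f ` VD ` ixs) = card (?f ` VB ` ixs)"
    by (simp_all only: cardI inj)
  show "card (?f ` targets_of) = 2 * card (?f ` VB ` ixs) + 2"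
  proof -
    have fin: "finite ixs" using V0(1) by simp
    have "card (?f ` targets_of) = card targets_of" by (rule card_to_nat)
    also have "\<dots> = card {vp, vq} + card (VB ` ixs) + card (VC ` ixs)"
      unfolding targets_of_def using fin by (subst card_Un_disjoint; (subst card_Un_disjoint)?) auto
    also have "\<dots> = 2 + card ixs + card ixs"
      unfolding card_image[OF inj_on_subset[OF inj(1) subset_UNIV]]
        card_image[OF inj_on_subset[OF inj(2) subset_UNIV]] by simp
    finally show ?thesis unfolding cardI[OF inj(1)] by simp
  qed
  show "?f ` VB ` ixs \<noteq> {}" by simp
  show "code_linkable (insert (?f vp) X)" if X: "code_linkable X" "X \<inter> ?S = {}" for X
  proof -
    obtain X' where X': "X = ?f ` X'" "lnk X'" using X(1) by (rule code_linkableE)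
    then have "lnk (insert vp X')" using X(2) inter by (intro lnk_insert_vp) auto
    then show ?thesis using code_linkable_image[of "insert vp X'"] X'(1) by simp
  qed
  show "code_linkable (insert (?f va) X)"
    if k: "k \<in> ?f ` VB ` ixs \<union> ?f ` VC ` ixs \<union> ?f ` VD ` ixs" "k \<notin> X" "X \<inter> ?S = {}"
      "code_linkable (insert k X)" for X k
  proof -
    have "k \<in> ?f ` (VB ` ixs \<union> VC ` ixs \<union> VD ` ixs)" using k(1) by (simp only: image_Un)
    then obtain k' where k': "k = ?f k'" "k' \<in> VB ` ixs \<union> VC ` ixs \<union> VD ` ixs" by (rule imageE)
    have "code_linkable X" using k(4) by (rule linkable_subset) blast
    then obtain X' where X': "X = ?f ` X'" by (rule code_linkableE)
    have "lnk (insert k' X')" using k(4) code_linkable_image[of "insert k' X'"] X' k'(1) by simp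
    moreover have "k' \<notin> X'" using k(2) X' k'(1) by blast
    moreover have "X' \<inter> srcs = {}" using k(3) X' inter by simp
    ultimately have "lnk (insert va X')" by (rule lnk_insert_va[OF k'(2), rotated 2])
    then show ?thesis using code_linkable_image[of "insert va X'"] X' by simp
  qed
  have Un: "insert (?f x) (insert (?f y) (?f ` Z \<union> ?f ` W)) = ?f ` insert x (insert y (Z \<union> W))"
    for x y Z W by (simp add: image_Un)
  show "code_linkable (insert (?f vp) (insert x (?f ` VB ` ixs \<union> ?f ` VC ` ixs)))"
    if x: "x \<in> ?f ` VD ` ixs" for x
  proof -
    obtain i where i: "i \<in> ixs" "x = ?f (VD i)" using x by blast
    show ?thesis unfolding i(2) Un code_linkable_image by (rule lnk_bases(1)[OF i(1)])
  qed
  show "code_linkable (insert (?f vp) (insert x (?f ` VB ` ixs \<union> ?f ` VD ` ixs)))"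
    if x: "x \<in> ?f ` VC ` ixs" for x
  proof -
    obtain i where i: "i \<in> ixs" "x = ?f (VC i)" using x by blast
    show ?thesis unfolding i(2) Un code_linkable_image by (rule lnk_bases(2)[OF i(1)])
  qed
  show "code_linkable (insert (?f vp) (insert x (?f ` VC ` ixs \<union> ?f ` VD ` ixs)))"
    if x: "x \<in> ?f ` VB ` ixs" for x
  proof -
    obtain i where i: "i \<in> ixs" "x = ?f (VB i)" using x by blast
    show ?thesis unfolding i(2) Un code_linkable_image by (rule lnk_bases(3)[OF i(1)])
  qed
qed

end

lemma contraction_indep:
  assumes "C \<in> indep_sets M"
  shows "contraction M C =
    \<lparr>ground = ground M - C, indep_sets = {X. X \<subseteq> ground M - C \<and> X \<union> C \<in> indep_sets M}\<rparr>"
proof -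
  have "basis_of M C B \<longleftrightarrow> B = C" for B
    using assms unfolding basis_of_def by blast
  then show ?thesis unfolding contraction_def by simp
qed

theorem theorem1p1:
  fixes N :: "'a pre_matroid"
  assumes "gammoid N"
  shows "\<exists>M :: nat pre_matroid. excluded_minor gammoid M \<and> has_minor M N"
proof -
  obtain V0 T0 out0 S0 where V0: "finite V0" "T0 \<subseteq> V0" and S0: "S0 \<subseteq> V0"
    and isoN: "matroid_iso N (digraph_gammoid V0 T0 out0 S0)"
    using assms by (rule gammoidE)
  let ?f = "to_nat :: vertex \<Rightarrow> nat"
  let ?I = "insert None (Some ` V0)"
  interpret gadget "?f ` verts_of V0" "?f ` targets_of V0" "code_out V0 out0"
     "?f vp" "?f va" "?f va1" "?f va2" "?f vb" "?f vc" "?f vd"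
     "?f ` VB ` ?I" "?f ` VC ` ?I" "?f ` VD ` ?I"
    by (rule gadget_code[OF V0])
  define K where "K = ?f ` contracted_set V0 T0"
  define R where "R = ?f ` VB ` Some ` S0"
  define M' where "M' = deletion (contraction relaxed K) (elems - K - R)"
  have K_elems: "K \<subseteq> elems" unfolding K_def contracted_set_def[OF V0] by auto
  have R_elems: "R \<subseteq> elems - K" using S0 unfolding R_def K_def contracted_set_def[OF V0] by auto
  have "?f (VB None) \<in> K" unfolding K_def contracted_set_def[OF V0] by auto
  moreover have "?f (VB None) \<notin> hyperplane" by auto
  ultimately have not_hyp: "X \<union> K \<noteq> hyperplane" for X by blast
  have iff: "?f ` VB ` Some ` X \<union> K \<in> indep_sets relaxed \<longleftrightarrow> linkable V0 T0 out0 X"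
    if "X \<subseteq> S0" for X
  proof -
    have "?f ` VB ` Some ` X \<union> K \<subseteq> elems" using that K_elems R_elems unfolding R_def by blast
    then have "?f ` VB ` Some ` X \<union> K \<in> indep_sets relaxed \<longleftrightarrow>
        indep (?f ` (VB ` Some ` X \<union> contracted_set V0 T0))"
      using not_hyp unfolding relaxed_simps K_def by (simp add: image_Un)
    also have "\<dots> \<longleftrightarrow> linkable V0 T0 out0 X"
      unfolding code_linkable_image[OF V0] using that S0 by (intro lnk_contracted_iff[OF V0]) auto
    finally show ?thesis .
  qed
  have "linkable V0 T0 out0 {}" by (intro linkableI[where g = id]) auto
  then have K_indep: "K \<in> indep_sets relaxed" using iff[of "{}"] by simp
  have M': "M' = \<lparr>ground = R, indep_sets = {X. X \<subseteq> R \<and> X \<union> K \<in> indep_sets relaxed}\<rparr>"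
    using R_elems unfolding M'_def contraction_indep[OF K_indep] deletion_def restriction_def
      relaxed_simps(1) by auto
  have "A - K - R \<subseteq> A" "K \<inter> (A - K - R) = {}" for A by blast+
  then have "is_minor M' relaxed"
    unfolding is_minor_def M'_def relaxed_simps(1)
    by (intro exI[of _ K] exI[of _ "elems - K - R"] conjI K_elems refl)
  moreover have "matroid_iso (digraph_gammoid V0 T0 out0 S0) M'"
    unfolding matroid_iso_def
  proof (intro exI[of _ "\<lambda>v. ?f (VB (Some v))"] conjI allI impI)
    show "bij_betw (\<lambda>v. ?f (VB (Some v))) (ground (digraph_gammoid V0 T0 out0 S0)) (ground M')"
      unfolding M' R_def by (auto simp: bij_betw_def inj_on_def digraph_gammoid_def image_image)
    fix X assume "X \<subseteq> ground (digraph_gammoid V0 T0 out0 S0)"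
    then have X: "X \<subseteq> S0" by (simp add: digraph_gammoid_def)
    have "(\<lambda>v. ?f (VB (Some v))) ` X = ?f ` VB ` Some ` X" by (simp add: image_image)
    then show "X \<in> indep_sets (digraph_gammoid V0 T0 out0 S0) \<longleftrightarrow>
        (\<lambda>v. ?f (VB (Some v))) ` X \<in> indep_sets M'"
      using iff[OF X] X unfolding M' R_def digraph_gammoid_def by auto
  qed
  then have "matroid_iso M' N"
    using isoN matroid_iso_sym matroid_iso_trans by blast
  ultimately have "has_minor relaxed N" unfolding has_minor_def by blast
  then show ?thesis using excluded_minor_relaxed by blast
qed

end
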